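(* Let $k\geq 3$ be an integer and let $\mathbb{K}$ be an algebraically closed field whose characteristic does not divide $k$. Let $G=(V,E)$ be a finite simple undirected graph with chromatic number $\chi(G)=k+1$ and girth $g>4k$. Then for every non-negative integer $d$ satisfying $$d+k-1<\frac{g}{4k},$$ the system (BCOL) of $G$ has no Nullstellensatz Certificate of degree at most $d$; that is, there are no polynomials $r_u$ ($u\in V$) and $r_{uv}$ ($\{u,v\}\in E$) in $\mathbb{K}[x_w: w\in V]$, each of degree at most $d$, such that $$\sum_{u\in V} r_u(x)\,(x_u^k-1)+\sum_{\{u,v\}\in E} r_{uv}(x)\,\frac{x_u^k-x_v^k}{x_u-x_v}=1 .$$
   Context: The system (BCOL) (Bayer's formulation of $k$-coloring of $G$) consists of the polynomial equations $p_u(x):=x_u^k-1=0$ for all $u\in V$ and $q_{uv}(x):=\frac{x_u^k-x_v^k}{x_u-x_v}=\sum_{r=0}^{k-1}x_u^{k-1-r}x_v^{r}=0$ for all edges $\{u,v\}\in E$, in variables $x_u$, $u\in V$. A Nullstellensatz Certificate of degree $d$ is a family of polynomials of degree at most $d$, one per equation, whose combination with the equations' polynomials equals the constant $1$. The girth is the length of a shortest cycle of $G$. *)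

theory Defs
  imports
    "HOL-Library.Poly_Mapping"
    "HOL-Library.Extended_Nat"
    "HOL-Library.Extended_Real"
    "HOL-Computational_Algebra.Computational_Algebra"
begin

section \<open>Finite simple graphs\<close>

definition simple_graph :: "'v set \<Rightarrow> 'v set set \<Rightarrow> bool" where
  "simple_graph V E \<longleftrightarrow> finite V \<and> (\<forall>e\<in>E. e \<subseteq> V \<and> card e = 2)"

definition proper_coloring :: "'v set \<Rightarrow> 'v set set \<Rightarrow> nat \<Rightarrow> ('v \<Rightarrow> nat) \<Rightarrow> bool" where
  "proper_coloring V E n c \<longleftrightarrow>
     (\<forall>v\<in>V. c v < n) \<and> (\<forall>u\<in>V. \<forall>v\<in>V. {u, v} \<in> E \<longrightarrow> c u \<noteq> c v)"

definition chromatic_number :: "'v set \<Rightarrow> 'v set set \<Rightarrow> nat" where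
  "chromatic_number V E = (LEAST n. \<exists>c. proper_coloring V E n c)"

text \<open>A cycle is given by the list of its distinct vertices in cyclic order, the first one not being
  repeated at the end; its length, i.e. its number of edges, is thus the length of the list.\<close>

definition is_cycle :: "'v set set \<Rightarrow> 'v list \<Rightarrow> bool" where
  "is_cycle E c \<longleftrightarrow>
     3 \<le> length c \<and> distinct c \<and>
     (\<forall>i<length c. {c ! i, c ! (Suc i mod length c)} \<in> E)"

text \<open>The girth of an acyclic graph is \<open>\<infinity>\<close>.\<close>

definition girth :: "'v set set \<Rightarrow> enat" where
  "girth E = (INF c\<in>{c. is_cycle E c}. enat (length c))"

section \<open>Multivariate polynomials\<close>

text \<open>A monomial is a finitely supported exponent vector \<open>'v \<Rightarrow>\<^sub>0 nat\<close>; the ring structure on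
  \<open>('v \<Rightarrow>\<^sub>0 nat) \<Rightarrow>\<^sub>0 'k\<close> supplied by the library (convolution product) is that of the polynomial
  ring over \<open>'k\<close> with one variable for each element of \<open>'v\<close>.\<close>

type_synonym ('v, 'k) mpoly = "('v \<Rightarrow>\<^sub>0 nat) \<Rightarrow>\<^sub>0 'k"

definition Var :: "'v \<Rightarrow> ('v, 'k::comm_ring_1) mpoly" where
  "Var v = Poly_Mapping.single (Poly_Mapping.single v 1) 1"

definition monomial_degree :: "('v \<Rightarrow>\<^sub>0 nat) \<Rightarrow> nat" where
  "monomial_degree m = (\<Sum>v\<in>Poly_Mapping.keys m. Poly_Mapping.lookup m v)"

text \<open>The zero polynomial has total degree \<open>0\<close>, so that it satisfies every bound
  \<open>total_degree p \<le> d\<close>.\<close>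

definition total_degree :: "('v, 'k::comm_ring_1) mpoly \<Rightarrow> nat" where
  "total_degree p = Max (insert 0 (monomial_degree ` Poly_Mapping.keys p))"

definition polys_in :: "'v set \<Rightarrow> ('v, 'k::comm_ring_1) mpoly set" where
  "polys_in V = {p. \<forall>m\<in>Poly_Mapping.keys p. Poly_Mapping.keys m \<subseteq> V}"

section \<open>Bayer's system\<close>

definition vertex_poly :: "nat \<Rightarrow> 'v \<Rightarrow> ('v, 'k::comm_ring_1) mpoly" where
  "vertex_poly k u = Var u ^ k - 1"

definition edge_quotient :: "nat \<Rightarrow> 'v \<Rightarrow> 'v \<Rightarrow> ('v, 'k::comm_ring_1) mpoly" where
  "edge_quotient k u v = (\<Sum>r<k. Var u ^ (k - 1 - r) * Var v ^ r)"

lemma edge_quotient_mult: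
  "(Var u - Var v) * edge_quotient k u v = Var u ^ k - (Var v ^ k :: ('v, 'k::comm_ring_1) mpoly)"
proof -
  have "Var v ^ k - Var u ^ k
      = (Var v - Var u) * (edge_quotient k u v :: ('v, 'k) mpoly)"
    using power_diff_sumr2[of "Var v :: ('v, 'k) mpoly" k "Var u"]
    by (simp add: edge_quotient_def)
  then show ?thesis
    by (simp add: algebra_simps)
qed

lemma edge_quotient_commute:
  "edge_quotient k u v = (edge_quotient k v u :: ('v, 'k::comm_ring_1) mpoly)"
  unfolding edge_quotient_def
  by (subst sum.nat_diff_reindex[symmetric]) (auto intro!: sum.cong simp: mult.commute)

text \<open>The polynomial of an unordered edge; well defined since \<^const>\<open>edge_quotient\<close> is symmetric in
  the two vertices.\<close>

definition edge_poly :: "nat \<Rightarrow> 'v set \<Rightarrow> ('v, 'k::comm_ring_1) mpoly" where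
  "edge_poly k e = (THE q. \<exists>u v. e = {u, v} \<and> q = edge_quotient k u v)"

lemma edge_poly_eq:
  "edge_poly k {u, v} = (edge_quotient k u v :: ('v, 'k::comm_ring_1) mpoly)"
  unfolding edge_poly_def
  by (rule the_equality) (auto simp: doubleton_eq_iff edge_quotient_commute)

end

theory Submission
  imports Defs
begin

text \<open>
  A proper colouring \<open>c\<close> of \<open>G\<close> with \<open>k + 1\<close> colours orients the edges, with descending paths of length
  at most \<open>k\<close>. The closure of a vertex set adds all vertices reachable by descending and all paths
  of length 2 or 3 between its vertices. If the set has at most \<open>d + 2\<close> elements, then every path
  added joins two different pieces of small diameter, since otherwise it would close a cycle shorter
  than the girth; hence the closure is bipartite.

  For bipartite closed sets \<open>U \<subseteq> W\<close>, the proper \<open>k\<close>-colourings of \<open>U\<close> extend to \<open>W\<close> in such a way that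
  the colour of a vertex depends only on preceding vertices of \<open>U\<close>. Hence in the lexicographic order
  a monomial in the variables of \<open>U\<close> that is a leading monomial of a polynomial vanishing on the
  colourings of \<open>W\<close> is already one for \<open>U\<close>. This consistency makes it possible to define a linear
  functional on polynomials by recursion on the monomials, reducing each monomial modulo the vanishing
  polynomials of the closure of its support. It maps 1 to 1, but annihilates all multiples of the
  equations that can occur in a certificate of degree \<open>d\<close>.
\<close>

section \<open>Path-closed vertex sets\<close>

text \<open>Ordered pairs instead of edges as sets, so that \<open>induced_edges E U ^^ n\<close>
  relates the ends of walks of length \<open>n\<close> inside \<open>U\<close>.\<close>

definition induced_edges :: "'v set set \<Rightarrow> 'v set \<Rightarrow> ('v \<times> 'v) set" where
  "induced_edges E U = {(p, q). p \<in> U \<and> q \<in> U \<and> {p, q} \<in> E}"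

lemma induced_edges_mono: "U \<subseteq> W \<Longrightarrow> induced_edges E U \<subseteq> induced_edges E W"
  by (auto simp: induced_edges_def)

lemma induced_edges_relpow_mono:
  assumes "U \<subseteq> W"
  shows "induced_edges E U ^^ n \<subseteq> induced_edges E W ^^ n"
  using relcomp_mono induced_edges_mono[OF assms] by (induction n) fastforce+

lemma induced_edges_relpow_sym:
  assumes "(p, q) \<in> induced_edges E U ^^ n"
  shows "(q, p) \<in> induced_edges E U ^^ n"
  using assms
proof (induction n arbitrary: q)
  case (Suc n)
  then obtain r where "(p, r) \<in> induced_edges E U ^^ n" "(r, q) \<in> induced_edges E U" by auto
  with Suc.IH have "(r, p) \<in> induced_edges E U ^^ n" "(q, r) \<in> induced_edges E U"
    by (auto simp: induced_edges_def insert_commute)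
  then show ?case by (rule relpow_Suc_I2[rotated])
qed auto

text \<open>Cycles are lists without repetition, so walks have to be turned into paths: if the next
  vertex already lies on the path, the path is cut off there.\<close>

lemma distinct_path_of_walk:
  assumes "(p, q) \<in> induced_edges E U ^^ n" "p \<in> U"
  obtains xs where "distinct xs" "xs \<noteq> []" "hd xs = p" "last xs = q" "set xs \<subseteq> U"
    "length xs \<le> Suc n" "successively (\<lambda>x y. {x, y} \<in> E) xs"
  using assms(1)
proof (induction n arbitrary: q thesis)
  case 0
  show ?case by (rule "0.prems"(1)[of "[p]"]) (use 0 assms(2) in auto)
next
  case (Suc n)
  then obtain r where r: "(p, r) \<in> induced_edges E U ^^ n" "r \<in> U" "q \<in> U" "{r, q} \<in> E"
    by (auto simp: induced_edges_def)
  obtain xs where xs: "distinct xs" "xs \<noteq> []" "hd xs = p" "last xs = r" "set xs \<subseteq> U"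
    "length xs \<le> Suc n" "successively (\<lambda>x y. {x, y} \<in> E) xs"
    using Suc.IH[OF _ r(1)] by blast
  show ?case
  proof (cases "q \<in> set xs")
    case True
    then obtain ys zs where ys: "xs = ys @ q # zs" by (meson split_list)
    show ?thesis
      by (rule Suc.prems(1)[of "ys @ [q]"])
        (use xs ys in \<open>auto simp: successively_append_iff hd_append successively_Cons\<close>)
  next
    case False
    show ?thesis
      by (rule Suc.prems(1)[of "xs @ [q]"])
        (use xs r False in \<open>auto simp: successively_append_iff\<close>)
  qed
qed

lemma is_cycle_of_path:
  assumes "distinct xs" "length xs \<ge> 3" "successively (\<lambda>x y. {x, y} \<in> E) xs" "{last xs, hd xs} \<in> E"
  shows "is_cycle E xs"
  unfolding is_cycle_def
proof (intro conjI allI impI)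
  fix i assume i: "i < length xs"
  show "{xs ! i, xs ! (Suc i mod length xs)} \<in> E"
  proof (cases "Suc i < length xs")
    case True
    then show ?thesis using assms(3) by (simp add: successively_conv_nth)
  next
    case False
    with i have "Suc i = length xs" by simp
    moreover have "xs \<noteq> []" using assms(2) by auto
    ultimately show ?thesis using assms(4)
      by (metis diff_Suc_1 hd_conv_nth last_conv_nth mod_self)
  qed
qed (use assms in auto)

text \<open>Edges descend towards the smaller label \<open>c\<close>. In the last clause, \<open>u = v\<close> is not
  excluded.\<close>

definition path_closed :: "'v set set \<Rightarrow> ('v \<Rightarrow> nat) \<Rightarrow> 'v set \<Rightarrow> bool" where
  "path_closed E c U \<longleftrightarrow>
     (\<forall>u\<in>U. \<forall>w. {u, w} \<in> E \<longrightarrow> c w < c u \<longrightarrow> w \<in> U) \<and>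
     (\<forall>w. \<forall>u\<in>U. \<forall>v\<in>U. w \<notin> U \<longrightarrow> {u, w} \<in> E \<longrightarrow> {v, w} \<in> E \<longrightarrow> u = v) \<and>
     (\<forall>a b. \<forall>u\<in>U. \<forall>v\<in>U. a \<notin> U \<longrightarrow> b \<notin> U \<longrightarrow> {a, b} \<in> E \<longrightarrow> {u, a} \<in> E \<longrightarrow> {v, b} \<notin> E)"

lemma path_closedD:
  assumes "path_closed E c U" "u \<in> U"
  shows path_closed_descend: "{u, w} \<in> E \<Longrightarrow> c w < c u \<Longrightarrow> w \<in> U"
    and path_closed_unique: "v \<in> U \<Longrightarrow> w \<notin> U \<Longrightarrow> {u, w} \<in> E \<Longrightarrow> {v, w} \<in> E \<Longrightarrow> u = v"
    and path_closed_no_hop: "v \<in> U \<Longrightarrow> a \<notin> U \<Longrightarrow> b \<notin> U \<Longrightarrow> {a, b} \<in> E \<Longrightarrow> {u, a} \<in> E \<Longrightarrow> {v, b} \<notin> E"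
  using assms unfolding path_closed_def by meson+

definition path_closure :: "'v set set \<Rightarrow> ('v \<Rightarrow> nat) \<Rightarrow> 'v set \<Rightarrow> 'v set" where
  "path_closure E c S = \<Inter> {U. S \<subseteq> U \<and> path_closed E c U}"

text \<open>Only the clause on paths of length 3 needs care: a member \<open>U\<close> of the family
  that omits \<open>a\<close> may contain \<open>b\<close>. Then \<open>a\<close> has the neighbours
  \<open>u\<close> and \<open>b\<close> in \<open>U\<close>, so \<open>u = b\<close>, although
  \<open>b\<close> lies outside the intersection.\<close>

lemma path_closed_Inter:
  assumes "\<And>U. U \<in> \<U> \<Longrightarrow> path_closed E c U"
  shows "path_closed E c (\<Inter>\<U>)"
proof -
  have unique: "u = v" if "u \<in> \<Inter>\<U>" "v \<in> \<Inter>\<U>" "w \<notin> \<Inter>\<U>" "{u, w} \<in> E" "{v, w} \<in> E" for u v w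
    using that path_closed_unique[OF assms] by (metis Inter_iff)
  have "{v, b} \<notin> E" if h: "u \<in> \<Inter>\<U>" "v \<in> \<Inter>\<U>" "a \<notin> \<Inter>\<U>" "b \<notin> \<Inter>\<U>" "{a, b} \<in> E" "{u, a} \<in> E" for u v a b
  proof
    assume vb: "{v, b} \<in> E"
    obtain U where U: "U \<in> \<U>" "a \<notin> U" using h by blast
    have "u \<in> U" "v \<in> U" using h U by auto
    show False
    proof (cases "b \<in> U")
      case True
      have "u = b"
        by (rule path_closed_unique[OF assms[OF U(1)] \<open>u \<in> U\<close> True U(2)])
          (use h in \<open>auto simp: insert_commute\<close>)
      then show False using h by blast
    next
      case False
      then show False using path_closed_no_hop[OF assms[OF U(1)] \<open>u \<in> U\<close> \<open>v \<in> U\<close> U(2)] h vb by blast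
    qed
  qed
  moreover have "w \<in> \<Inter>\<U>" if "u \<in> \<Inter>\<U>" "{u, w} \<in> E" "c w < c u" for u w
    using that path_closed_descend[OF assms] by (meson InterD InterI)
  ultimately show ?thesis using unique unfolding path_closed_def by meson
qed

lemma path_closed_path_closure: "path_closed E c (path_closure E c S)"
  unfolding path_closure_def by (rule path_closed_Inter) auto

lemma subset_path_closure: "S \<subseteq> path_closure E c S"
  unfolding path_closure_def by blast

lemma path_closure_least: "S \<subseteq> U \<Longrightarrow> path_closed E c U \<Longrightarrow> path_closure E c S \<subseteq> U"
  unfolding path_closure_def by blast

text \<open>Keeps the closures of subsets of \<open>V\<close> inside \<open>V\<close>.\<close>

lemma path_closed_vertices:
  assumes "\<And>u v. {u, v} \<in> E \<Longrightarrow> u \<in> V"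
  shows "path_closed E c V"
proof -
  have "w \<in> V" if "{u, w} \<in> E" for u w
    using assms[of w u] that by (simp add: insert_commute)
  then show ?thesis unfolding path_closed_def by blast
qed

section \<open>Bipartiteness of closures\<close>

definition two_colouring :: "'v set set \<Rightarrow> 'v set \<Rightarrow> ('v \<Rightarrow> bool) \<Rightarrow> bool" where
  "two_colouring E U \<chi> \<longleftrightarrow> (\<forall>p\<in>U. \<forall>q\<in>U. {p, q} \<in> E \<longrightarrow> \<chi> p \<noteq> \<chi> q)"

text \<open>The invariant under adding vertices to \<open>U\<close>: the map \<open>f\<close> labels the pieces of \<open>U\<close>; a piece with \<open>n\<close> vertices from \<open>S\<close> has diameter
  at most \<open>(n - 1) (2k + 3) + 2k\<close>. The bound on the distance of \<open>p\<close> and \<open>q\<close> is sharpened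
  by \<open>c p + c q\<close>, which pays for the descending edges.\<close>

definition piece :: "'v set \<Rightarrow> ('v \<Rightarrow> 'v) \<Rightarrow> 'v set \<Rightarrow> 'v \<Rightarrow> 'v set" where
  "piece S f U i = {x \<in> S \<inter> U. f x = i}"

text \<open>The summand \<open>2 * k + 3\<close> stands on the left of the inequality to avoid a
  truncated subtraction. Labels are taken from \<open>U\<close>, so that a vertex outside
  \<open>U\<close> can serve as a fresh label.\<close>

definition assembled :: "'v set set \<Rightarrow> ('v \<Rightarrow> nat) \<Rightarrow> nat \<Rightarrow> 'v set \<Rightarrow> 'v set \<Rightarrow> ('v \<Rightarrow> 'v) \<Rightarrow> ('v \<Rightarrow> bool) \<Rightarrow> bool" where
  "assembled E c k S U f \<chi> \<longleftrightarrow>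
     two_colouring E U \<chi> \<and>
     (\<forall>p\<in>U. f p \<in> U \<and> piece S f U (f p) \<noteq> {}) \<and>
     (\<forall>p\<in>U. \<forall>q\<in>U. {p, q} \<in> E \<longrightarrow> f p = f q) \<and>
     (\<forall>p\<in>U. \<forall>q\<in>U. f p = f q \<longrightarrow>
        (\<exists>n. n + (2 * k + 3) + c p + c q \<le> card (piece S f U (f p)) * (2 * k + 3) + 2 * k \<and>
           (p, q) \<in> induced_edges E U ^^ n))"

text \<open>A piece containing all of \<open>S\<close> has diameter at most
  \<open>(s - 1) * (2 * k + 3) + 2 * k\<close>, and closing a path in it through one or two outside
  vertices takes at most 3 more edges. Hence the threshold \<open>s * (2 * k + 3)\<close> for cycle
  lengths.\<close>

locale long_cycles =
  fixes E :: "'v set set" and c :: "'v \<Rightarrow> nat" and k s :: nat and S :: "'v set"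
  assumes c_le: "{u, v} \<in> E \<Longrightarrow> c u \<le> k"
    and c_neq: "{u, v} \<in> E \<Longrightarrow> c u \<noteq> c v"
    and S: "finite S" "card S \<le> s" "\<And>x. x \<in> S \<Longrightarrow> c x \<le> k"
    and cycle_length: "is_cycle E xs \<Longrightarrow> length xs > s * (2 * k + 3)"
    and s_pos: "s > 0"
begin

lemma no_loop: "{u, u} \<notin> E"
  using c_neq[of u u] by auto

lemma card_piece_le: "card (piece S f U i) \<le> s"
  using card_mono[OF S(1), of "piece S f U i"] S(2) by (fastforce simp: piece_def)

text \<open>Each piece receives at most one edge from \<open>{a, b}\<close>: two such edges,
  together with a path inside the piece and possibly the edge \<open>{a, b}\<close>, would form too
  short a cycle.\<close>

lemma closing_edge_unique:
  assumes U: "assembled E c k S U f \<chi>" and out: "a \<notin> U" "b \<notin> U" and ab: "a = b \<or> {a, b} \<in> E"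
    and x: "x \<in> {a, b}" "u \<in> U" "{x, u} \<in> E"
    and y: "y \<in> {a, b}" "v \<in> U" "{y, v} \<in> E"
    and f: "f u = f v"
  shows "x = y \<and> u = v"
proof (rule ccontr)
  assume neq: "\<not> (x = y \<and> u = v)"
  obtain n where n: "n + (2 * k + 3) + c u + c v \<le> card (piece S f U (f u)) * (2 * k + 3) + 2 * k"
    "(u, v) \<in> induced_edges E U ^^ n"
    using U x y f unfolding assembled_def by meson
  obtain p where p: "distinct p" "p \<noteq> []" "hd p = u" "last p = v" "set p \<subseteq> U"
    "length p \<le> Suc n" "successively (\<lambda>x y. {x, y} \<in> E) p"
    using distinct_path_of_walk[OF n(2) x(2)] .
  have "card (piece S f U (f u)) * (2 * k + 3) \<le> s * (2 * k + 3)"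
    using card_piece_le by (intro mult_le_mono) auto
  \<comment> \<open>The path has at most \<open>n + 1\<close> vertices and at most two are added, so
    the cycle has length at most \<open>n + 3\<close>.\<close>
  with n(1) have len: "n + 3 \<le> s * (2 * k + 3)" by linarith
  have sy: "{u, x} \<in> E" "{v, y} \<in> E" using x y by (auto simp: insert_commute)
  show False
  proof (cases "x = y")
    case True
    then have "u \<noteq> v" using neq by blast
    then have "length p \<ge> 2" using p by (cases p; cases "tl p") auto
    have "is_cycle E (p @ [x])"
      by (rule is_cycle_of_path)
        (use p x out sy True \<open>length p \<ge> 2\<close> in \<open>auto simp: successively_append_iff\<close>)
    then show False using cycle_length[of "p @ [x]"] len p by simp
  next
    case False
    then have "{y, x} \<in> E" using ab x y by (auto simp: insert_commute)
    have "length p \<ge> 1" using p by (cases p) auto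
    have "is_cycle E (p @ [y, x])"
      by (rule is_cycle_of_path)
        (use p x y out sy False \<open>{y, x} \<in> E\<close> \<open>length p \<ge> 1\<close> in \<open>auto simp: successively_append_iff\<close>)
    then show False using cycle_length[of "p @ [y, x]"] len p by simp
  qed
qed

text \<open>One closure operation, adding a single vertex (\<open>a = b\<close>) or the two inner
  vertices of a path of length 3. All pieces that receive an edge from \<open>{a, b}\<close> are
  merged, with the new vertices, into one piece labelled \<open>a\<close>. As each of them receives
  only one edge, their two-colourings can be adjusted independently.\<close>

lemma assembled_step:
  assumes U: "assembled E c k S U f \<chi>" and out: "a \<notin> U" "b \<notin> U" and ab: "a = b \<or> {a, b} \<in> E"
    and c_ab: "c a \<le> k" "c b \<le> k"
    and grow: "a = b \<and> a \<in> S \<or> a = b \<and> (\<exists>u\<in>U. {a, u} \<in> E \<and> c a < c u) \<or>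
      (\<exists>x\<in>{a, b}. \<exists>y\<in>{a, b}. \<exists>u\<in>U. \<exists>v\<in>U. {x, u} \<in> E \<and> {y, v} \<in> E \<and> (x, u) \<noteq> (y, v))"
  shows "\<exists>f' \<chi>'. assembled E c k S (insert a (insert b U)) f' \<chi>'"
proof -
  define M where "M = 2 * k + 3"
  define N where "N i = card (piece S f U i)" for i
  define att where "att x u \<longleftrightarrow> x \<in> {a, b} \<and> u \<in> U \<and> {x, u} \<in> E" for x u
  define J where "J = {f u | x u. att x u}"
  define W where "W = insert a (insert b U)"
  define f' where "f' p = (if p \<notin> U \<or> f p \<in> J then a else f p)" for p
  \<comment> \<open>The new vertex \<open>a\<close> gets colour \<open>True\<close> and
    \<open>b\<close>, if different, gets \<open>False\<close>. A piece is flipped if the end of its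
    attaching edge collides with this.\<close>
  define flip where "flip j \<longleftrightarrow> (\<exists>x u. att x u \<and> f u = j \<and> (\<chi> u \<longleftrightarrow> x = a))" for j
  define \<chi>' where "\<chi>' p \<longleftrightarrow> (if p \<in> U then \<chi> p \<noteq> flip (f p) else p = a)" for p
  define P where "P = piece S f' W a"

  have colour: "\<chi> p \<noteq> \<chi> q" and same: "f p = f q" if "p \<in> U" "q \<in> U" "{p, q} \<in> E" for p q
    using U that unfolding assembled_def two_colouring_def by blast+
  have fU: "f p \<in> U" and N_pos: "N (f p) > 0" if "p \<in> U" for p
    using U that S(1) by (auto simp: assembled_def N_def card_gt_0_iff piece_def)
  have walk: "\<exists>n. n + M + c p + c q \<le> N (f p) * M + 2 * k \<and> (p, q) \<in> induced_edges E W ^^ n"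
    if "p \<in> U" "q \<in> U" "f p = f q" for p q
  proof -
    have "induced_edges E U ^^ n \<subseteq> induced_edges E W ^^ n" for n
      by (rule induced_edges_relpow_mono) (auto simp: W_def)
    then show ?thesis using U that unfolding assembled_def M_def N_def by blast
  qed
  have uniq: "x = y \<and> u = v" if "att x u" "att y v" "f u = f v" for x y u v
    using closing_edge_unique[OF U out ab] that unfolding att_def by blast

  have P_eq: "P = {x \<in> S \<inter> U. f x \<in> J} \<union> (S \<inter> {a, b})"
    using out fU by (auto simp: P_def piece_def f'_def W_def split: if_splits)
  have piece_other: "piece S f' W i = piece S f U i" if "i \<in> U" "i \<notin> J" for i
    using that out by (auto simp: piece_def f'_def W_def split: if_splits)
  have finP: "finite P" using S(1) by (simp add: P_eq)
  have N_le: "N j \<le> card P" if "j \<in> J" for j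
    unfolding N_def using that by (intro card_mono finP) (auto simp: P_eq piece_def)
  have N_add_le: "N i + N j \<le> card P" if "i \<in> J" "j \<in> J" "i \<noteq> j" for i j
  proof -
    have "N i + N j = card (piece S f U i \<union> piece S f U j)"
      unfolding N_def using that S(1) by (intro card_Un_disjoint[symmetric]) (auto simp: piece_def)
    also have "\<dots> \<le> card P"
      using that by (intro card_mono finP) (auto simp: P_eq piece_def)
    finally show ?thesis .
  qed
  have J_pos: "N j > 0" if "j \<in> J" for j
    using that N_pos by (auto simp: J_def att_def)
  have slack_other: "N j < card P" if "i \<in> J" "j \<in> J" "i \<noteq> j" for i j
    using N_add_le[OF that] J_pos[OF that(1)] by simp
  \<comment> \<open>This pays for the longer distances: either the merged piece has an additional
    vertex of \<open>S\<close>, worth \<open>M\<close>, or the only new vertex lies below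
    \<open>u\<close>, and the step from \<open>u\<close> to it is covered by the drop of
    \<open>c\<close>.\<close>
  have slack: "N j < card P \<or> a = b \<and> c a < c u" if "att x u" "j = f u" for x u j
  proof -
    have jJ: "j \<in> J" using that by (auto simp: J_def)
    from grow consider (start) "a = b" "a \<in> S"
      | (descend) v where "a = b" "att a v" "c a < c v"
      | (join) y z v w where "att y v" "att z w" "(y, v) \<noteq> (z, w)"
      unfolding att_def by blast
    then show ?thesis
    proof cases
      case start
      have "insert a (piece S f U j) \<subseteq> P"
        using start jJ by (auto simp: P_eq piece_def)
      then have "card (insert a (piece S f U j)) \<le> card P" by (rule card_mono[OF finP])
      moreover have "a \<notin> piece S f U j" "finite (piece S f U j)"
        using out S(1) by (auto simp: piece_def)
      ultimately have "N j < card P" unfolding N_def by simp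
      then show ?thesis ..
    next
      case descend
      show ?thesis
      proof (cases "f v = j")
        case True
        then have "f u = f v" using that by simp
        then have "u = v" using uniq[OF that(1) descend(2)] by blast
        then show ?thesis using descend by blast
      next
        case False
        have "f v \<in> J" using descend by (auto simp: J_def)
        then show ?thesis using slack_other[OF _ jJ False] by blast
      qed
    next
      case join
      then have "f v \<noteq> f w" using uniq by blast
      moreover have "f v \<in> J" "f w \<in> J" using join by (auto simp: J_def)
      ultimately show ?thesis using slack_other[OF _ jJ] by metis
    qed
  qed
  have P_pos: "card P > 0" and P_two: "a = b \<or> card P > 1"
  proof -
    have "(\<exists>j\<in>J. True) \<or> a \<in> S \<and> a = b" using grow by (auto simp: J_def att_def)
    moreover have "0 < card P" if "a \<in> S" using that finP by (auto simp: P_eq card_gt_0_iff)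
    ultimately show "card P > 0" using N_le J_pos by (metis gr0I not_less_zero less_le_trans)
    show "a = b \<or> card P > 1"
    proof (cases "a = b")
      case False
      then obtain y z v w where "att y v" "att z w" "(y, v) \<noteq> (z, w)"
        using grow unfolding att_def by blast
      then have "f v \<noteq> f w" "f v \<in> J" "f w \<in> J" using uniq by (blast, auto simp: J_def)
      then show ?thesis using slack_other[of "f v" "f w"] J_pos[of "f w"] by linarith
    qed simp
  qed

  have step: "(x, y) \<in> induced_edges E W \<and> (y, x) \<in> induced_edges E W" if "att x y" for x y
    using that by (auto simp: induced_edges_def att_def W_def insert_commute)
  have ab_walk: "\<exists>n\<le>1. (x, y) \<in> induced_edges E W ^^ n \<and> (a = b \<longrightarrow> n = 0)" if "x \<in> {a, b}" "y \<in> {a, b}" for x y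
  proof (cases "x = y")
    case True
    then show ?thesis by (intro exI[of _ 0]) auto
  next
    case False
    then have "(x, y) \<in> induced_edges E W"
      using that ab by (auto simp: induced_edges_def W_def insert_commute)
    then show ?thesis using False that by (intro exI[of _ 1]) auto
  qed
  have c_le_k: "c x \<le> k" if "x \<in> {a, b}" for x using that c_ab by auto
  have mult_M: "n * M + M \<le> m * M" if "n < m" for n m :: nat
    using mult_le_mono1[of "Suc n" m M] that by simp
  have out_walk: "\<exists>m. m + M + c p + c y \<le> card P * M + 2 * k \<and> (p, y) \<in> induced_edges E W ^^ m"
    if p: "p \<in> U" "f p \<in> J" and y: "y \<in> {a, b}" for p y
  proof -
    obtain x u where xu: "att x u" "f u = f p" using p by (auto simp: J_def)
    obtain n where n: "n + M + c p + c u \<le> N (f p) * M + 2 * k" "(p, u) \<in> induced_edges E W ^^ n"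
      using walk[of p u] p xu by (auto simp: att_def)
    obtain m where m: "m \<le> 1" "(x, y) \<in> induced_edges E W ^^ m" "a = b \<longrightarrow> m = 0"
      using ab_walk[of x y] xu y by (auto simp: att_def)
    have "(p, y) \<in> induced_edges E W ^^ (Suc n + m)"
      unfolding relpow_add using n(2) step[OF xu(1)] m(2) by auto
    moreover have "Suc n + m + M + c p + c y \<le> card P * M + 2 * k"
      using slack[OF xu(1) refl]
    proof
      \<comment> \<open>At most two further edges and \<open>c y \<le> k\<close> cost at most
        \<open>k + 2\<close>, which is less than \<open>M\<close>.\<close>
      assume "N (f u) < card P"
      then have "N (f p) * M + M \<le> card P * M" using xu mult_M by simp
      then show ?thesis using n(1) m(1) c_le_k[OF y] by (simp add: M_def)
    next
      assume h: "a = b \<and> c a < c u"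
      then have "m = 0" "c y < c u" using m y by auto
      moreover have "N (f p) * M \<le> card P * M" using N_le[OF p(2)] by simp
      ultimately show ?thesis using n(1) by linarith
    qed
    ultimately show ?thesis by blast
  qed
  have cross_walk: "\<exists>m. m + M + c p + c q \<le> card P * M + 2 * k \<and> (p, q) \<in> induced_edges E W ^^ m"
    if p: "p \<in> U" "f p \<in> J" and q: "q \<in> U" "f q \<in> J" for p q
  proof (cases "f p = f q")
    case True
    moreover have "N (f p) * M \<le> card P * M" using N_le[OF p(2)] by simp
    ultimately show ?thesis using walk[of p q] p q by (meson add_le_mono1 le_trans)
  next
    case False
    obtain x u where xu: "att x u" "f u = f p" using p by (auto simp: J_def)
    obtain y v where yv: "att y v" "f v = f q" using q by (auto simp: J_def)
    obtain n where n: "n + M + c p + c u \<le> N (f p) * M + 2 * k" "(p, u) \<in> induced_edges E W ^^ n"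
      using walk[of p u] p xu by (auto simp: att_def)
    obtain n' where n': "n' + M + c v + c q \<le> N (f v) * M + 2 * k" "(v, q) \<in> induced_edges E W ^^ n'"
      using walk[of v q] q yv by (auto simp: att_def)
    obtain m where m: "m \<le> 1" "(x, y) \<in> induced_edges E W ^^ m"
      using ab_walk[of x y] xu yv by (auto simp: att_def)
    have "(p, x) \<in> induced_edges E W ^^ Suc n" "(y, q) \<in> induced_edges E W ^^ Suc n'"
      using relpow_Suc_I[OF n(2)] relpow_Suc_I2[OF _ n'(2)] step[OF xu(1)] step[OF yv(1)] by blast+
    then have "(p, q) \<in> induced_edges E W ^^ (Suc n + m + Suc n')"
      unfolding relpow_add using m(2) by blast
    moreover have "N (f p) * M + N (f v) * M \<le> card P * M"
      using N_add_le[of "f p" "f q"] p q False yv by (metis add_mult_distrib mult_le_mono1)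
    \<comment> \<open>The value of \<open>M\<close> is tight here: it covers the second allowance
      \<open>2 * k\<close> and up to three connecting edges.\<close>
    then have "(Suc n + m + Suc n') + M + c p + c q \<le> card P * M + 2 * k"
      using n(1) n'(1) m(1) by (simp add: M_def)
    ultimately show ?thesis by blast
  qed

  have "assembled E c k S W f' \<chi>'"
    unfolding assembled_def two_colouring_def
  proof (intro conjI ballI impI)
    fix p q assume pq: "p \<in> W" "q \<in> W" "{p, q} \<in> E"
    have att_colour: "\<chi>' x \<noteq> \<chi>' u" if "att x u" for x u
    proof -
      have "flip (f u) \<longleftrightarrow> (\<chi> u \<longleftrightarrow> x = a)" using uniq[OF that] that unfolding flip_def by metis
      then show ?thesis using that out by (auto simp: \<chi>'_def att_def)
    qed
    have att_f: "f' x = f' u" if "att x u" for x u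
      using that out by (auto simp: f'_def att_def J_def)
    consider "p \<in> U" "q \<in> U" | "att p q" | "att q p" | "p \<notin> U" "q \<notin> U"
      using pq by (auto simp: att_def W_def insert_commute)
    then have "\<chi>' p \<noteq> \<chi>' q \<and> f' p = f' q"
    proof cases
      case 1
      then show ?thesis using colour[OF 1 pq(3)] same[OF 1 pq(3)] by (simp add: \<chi>'_def f'_def)
    next
      case 2
      then show ?thesis using att_colour att_f by blast
    next
      case 3
      then show ?thesis using att_colour att_f by metis
    next
      case 4
      then have "p \<noteq> q" "p \<in> {a, b}" "q \<in> {a, b}" using pq no_loop by (auto simp: W_def)
      with 4 show ?thesis by (auto simp: \<chi>'_def f'_def)
    qed
    then show "\<chi>' p \<noteq> \<chi>' q" "f' p = f' q" by auto
  next
    fix p assume p: "p \<in> W"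
    show "f' p \<in> W" using fU p by (auto simp: f'_def W_def)
    show "piece S f' W (f' p) \<noteq> {}"
    proof (cases "p \<notin> U \<or> f p \<in> J")
      case True
      then have "f' p = a" by (auto simp: f'_def)
      then show ?thesis using P_pos by (auto simp: P_def card_gt_0_iff)
    next
      case False
      then show ?thesis
        using piece_other[of "f p"] fU[of p] N_pos[of p] by (auto simp: f'_def N_def)
    qed
  next
    fix p q assume pq: "p \<in> W" "q \<in> W" "f' p = f' q"
    show "\<exists>n. n + (2 * k + 3) + c p + c q \<le> card (piece S f' W (f' p)) * (2 * k + 3) + 2 * k \<and>
           (p, q) \<in> induced_edges E W ^^ n"
    proof (cases "f' p = a")
      case True
      then have eq: "piece S f' W (f' p) = P" by (simp add: P_def)
      have p: "p \<in> {a, b} \<or> p \<in> U \<and> f p \<in> J" and q: "q \<in> {a, b} \<or> q \<in> U \<and> f q \<in> J"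
        using True pq out fU by (auto simp: f'_def W_def split: if_splits)
      have "\<exists>m. m + M + c p + c q \<le> card P * M + 2 * k \<and> (p, q) \<in> induced_edges E W ^^ m"
      proof -
        consider "p \<in> {a, b}" "q \<in> {a, b}" | "p \<in> {a, b}" "q \<in> U" "f q \<in> J"
          | "p \<in> U" "f p \<in> J" "q \<in> {a, b}" | "p \<in> U" "f p \<in> J" "q \<in> U" "f q \<in> J"
          using p q by blast
        then show ?thesis
        proof cases
          case 1
          obtain n where n: "n \<le> 1" "(p, q) \<in> induced_edges E W ^^ n" "a = b \<longrightarrow> n = 0"
            using ab_walk[OF 1] by blast
          \<comment> \<open>The labels of two new vertices may exhaust the allowance
            \<open>2 * k\<close>, so an edge between \<open>a\<close> and \<open>b\<close> has to be
            paid by a second vertex of \<open>S\<close> in the merged piece.\<close>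
          have "n + M \<le> card P * M"
          proof (cases "a = b")
            case True
            then show ?thesis using mult_le_mono1[of 1 "card P" M] P_pos n by simp
          next
            case False
            then show ?thesis using mult_le_mono1[of 2 "card P" M] P_two n by (simp add: M_def)
          qed
          then have "n + M + c p + c q \<le> card P * M + 2 * k"
            using c_le_k[OF 1(1)] c_le_k[OF 1(2)] by simp
          then show ?thesis using n by blast
        next
          case 2
          then obtain m where "m + M + c q + c p \<le> card P * M + 2 * k" "(q, p) \<in> induced_edges E W ^^ m"
            using out_walk by blast
          then show ?thesis using induced_edges_relpow_sym by (intro exI[of _ m]) auto
        next
          case 3
          then show ?thesis using out_walk by blast
        next
          case 4
          then show ?thesis using cross_walk by blast
        qed
      qed
      then show ?thesis by (simp add: eq M_def)
    next
      case False
      then have h: "p \<in> U" "q \<in> U" "f p \<notin> J" "f p = f q" "f' p = f p"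
        using pq by (auto simp: f'_def split: if_splits)
      then show ?thesis
        using walk[of p q] piece_other[of "f p"] fU[of p] by (simp add: M_def N_def)
    qed
  qed
  then show ?thesis unfolding W_def by blast
qed

text \<open>A maximal assembled subset \<open>U\<close> of \<open>V\<close> admits no further step.
  It therefore contains \<open>S\<close> and is path-closed, so it contains the closure, which
  inherits its two-colouring.\<close>

lemma path_closure_two_colourable: "\<exists>\<chi>. two_colouring E (path_closure E c S) \<chi>"
  if fin: "finite V" and SV: "S \<subseteq> V" and EV: "\<And>u v. {u, v} \<in> E \<Longrightarrow> u \<in> V"
proof -
  have EV': "{u, v} \<in> E \<Longrightarrow> v \<in> V" for u v using EV[of v u] by (simp add: insert_commute)
  have c_le': "{u, v} \<in> E \<Longrightarrow> c v \<le> k" for u v using c_le[of v u] by (simp add: insert_commute)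
  define Q where "Q U \<longleftrightarrow> U \<subseteq> V \<and> (\<exists>f \<chi>. assembled E c k S U f \<chi>)" for U
  have "Q {}" by (simp add: Q_def assembled_def two_colouring_def)
  have "finite {U. Q U}" by (rule finite_subset[of _ "Pow V"]) (auto simp: Q_def fin)
  with \<open>Q {}\<close> obtain U where U: "Q U" and maxU: "\<And>W. Q W \<Longrightarrow> U \<subseteq> W \<Longrightarrow> W = U"
    using finite_has_maximal[of "{U. Q U}"] by auto
  then obtain f \<chi> where asm: "assembled E c k S U f \<chi>" and UV: "U \<subseteq> V" unfolding Q_def by blast
  have stuck: False
    if "a \<in> V" "b \<in> V" "a \<notin> U" "b \<notin> U" "a = b \<or> {a, b} \<in> E" "c a \<le> k" "c b \<le> k"
      "a = b \<and> a \<in> S \<or> a = b \<and> (\<exists>u\<in>U. {a, u} \<in> E \<and> c a < c u) \<or>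
      (\<exists>x\<in>{a, b}. \<exists>y\<in>{a, b}. \<exists>u\<in>U. \<exists>v\<in>U. {x, u} \<in> E \<and> {y, v} \<in> E \<and> (x, u) \<noteq> (y, v))" for a b
  proof -
    have "Q (insert a (insert b U))"
      using assembled_step[OF asm that(3-)] that UV unfolding Q_def by blast
    then show False using maxU[of "insert a (insert b U)"] that by blast
  qed
  have "S \<subseteq> U"
  proof
    fix x assume "x \<in> S"
    then show "x \<in> U" using stuck[of x x] SV S(3) by blast
  qed
  moreover have "path_closed E c U"
    unfolding path_closed_def
  proof (intro conjI ballI allI impI)
    fix u w assume h: "u \<in> U" "{u, w} \<in> E" "c w < c u"
    have "{w, u} \<in> E" using h by (simp add: insert_commute)
    then show "w \<in> U" using stuck[of w w] h EV'[OF h(2)] c_le'[OF h(2)] by blast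
  next
    fix w u v assume h: "u \<in> U" "v \<in> U" "w \<notin> U" "{u, w} \<in> E" "{v, w} \<in> E"
    have "{w, u} \<in> E" "{w, v} \<in> E" using h by (simp_all add: insert_commute)
    then show "u = v" using stuck[of w w] h EV'[OF h(4)] c_le'[OF h(4)] by blast
  next
    fix a b u v assume h: "u \<in> U" "v \<in> U" "a \<notin> U" "b \<notin> U" "{a, b} \<in> E" "{u, a} \<in> E"
    show "{v, b} \<notin> E"
    proof
      assume vb: "{v, b} \<in> E"
      have "{a, u} \<in> E" "{b, v} \<in> E" using h vb by (simp_all add: insert_commute)
      moreover have "a \<noteq> b" using h no_loop by auto
      ultimately show False
        using stuck[of a b] h vb EV'[OF h(6)] EV'[OF vb] c_le'[OF h(6)] c_le'[OF vb] by blast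
    qed
  qed
  ultimately have "path_closure E c S \<subseteq> U" by (rule path_closure_least)
  moreover have "two_colouring E U \<chi>" using asm by (simp add: assembled_def)
  ultimately have "two_colouring E (path_closure E c S) \<chi>" unfolding two_colouring_def by blast
  then show ?thesis by blast
qed

end

section \<open>Roots of unity and reduced monomials\<close>

definition roots_of_unity :: "nat \<Rightarrow> 'k::field set" where
  "roots_of_unity k = {z. z ^ k = 1}"

lemma finite_roots_of_unity:
  assumes "k > 0"
  shows "finite (roots_of_unity k :: 'k::field set)"
proof -
  have "coeff (monom 1 k - 1 :: 'k poly) k = 1" using assms by simp
  then have "monom 1 k - 1 \<noteq> (0 :: 'k poly)" by (metis coeff_0 zero_neq_one)
  then have "finite {z :: 'k. poly (monom 1 k - 1) z = 0}" by (rule poly_roots_finite)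
  then show ?thesis by (simp add: roots_of_unity_def poly_monom)
qed

text \<open>The polynomial \<open>X^k - 1\<close> splits, and a multiple root would also be a root
  of its derivative \<open>k X^(k-1)\<close>, hence zero.\<close>

lemma card_roots_of_unity:
  assumes "\<not> CHAR('k::alg_closed_field) dvd k"
  shows "card (roots_of_unity k :: 'k set) = k"
proof -
  have "k > 0" using assms by (intro Nat.gr0I) auto
  define p :: "'k poly" where "p = monom 1 k - 1"
  have p_eval: "poly p x = x ^ k - 1" for x by (simp add: p_def poly_monom)
  have "coeff p k = 1" using \<open>k > 0\<close> by (simp add: p_def)
  moreover have "degree p \<le> k" unfolding p_def by (intro degree_diff_le degree_monom_le) simp
  ultimately have deg: "degree p = k" by (metis le_antisym le_degree zero_neq_one)
  then have "p \<noteq> 0" using \<open>k > 0\<close> by auto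
  then obtain A where A: "size A = k" "p = smult (lead_coeff p) (\<Prod>x\<in>#A. [:-x, 1:])"
    using alg_closed_imp_factorization deg by metis
  have root_iff: "poly p x = 0 \<longleftrightarrow> x \<in># A" for x
  proof -
    have "poly p x = lead_coeff p * (\<Prod>a\<in>#A. x - a)"
      by (subst A(2)) (simp add: poly_prod_mset image_mset.compositionality o_def)
    then show ?thesis using \<open>p \<noteq> 0\<close> by (auto simp: prod_mset_zero_iff)
  qed
  have "count A x \<le> 1" for x
  proof (rule ccontr)
    assume "\<not> count A x \<le> 1"
    then have "replicate_mset 2 x \<subseteq># A" by (simp add: count_le_replicate_mset_subset_eq[symmetric])
    then obtain B where "A = replicate_mset 2 x + B" by (metis subset_mset.add_diff_inverse)
    then have "p = [:-x, 1:] * ([:-x, 1:] * smult (lead_coeff p) (\<Prod>x\<in>#B. [:-x, 1:]))"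
      by (subst A(2)) (simp add: numeral_2_eq_2)
    then obtain q where q: "p = [:-x, 1:] * ([:-x, 1:] * q)" by blast
    have "poly (pderiv p) x = 0" unfolding q pderiv_mult by simp
    moreover have "pderiv p = monom (of_nat k) (k - 1)" by (simp add: p_def pderiv_diff pderiv_monom)
    ultimately have "of_nat k * x ^ (k - 1) = 0" by (simp add: poly_monom)
    moreover have "of_nat k \<noteq> (0 :: 'k)" using assms by (simp add: of_nat_eq_0_iff_char_dvd)
    moreover have "x ^ k = 1" using q p_eval[of x] by simp
    then have "x \<noteq> 0" using \<open>k > 0\<close> by (auto simp: power_0_left)
    ultimately show False by simp
  qed
  then have "size A = card (set_mset A)"
    unfolding size_multiset_overloaded_eq by (subst card_eq_sum, intro sum.cong) (auto simp: le_antisym Suc_leI)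
  moreover have "set_mset A = roots_of_unity k"
    using root_iff p_eval by (auto simp: roots_of_unity_def)
  ultimately show ?thesis using A(1) by simp
qed

text \<open>A geometric sum in \<open>x / z\<close>: the inverse discrete Fourier transform gives
  the indicator of \<open>z\<close> as a polynomial of degree below \<open>k\<close>.\<close>

lemma roots_of_unity_indicator:
  fixes x z :: "'k::field"
  assumes "of_nat k \<noteq> (0 :: 'k)" "x \<in> roots_of_unity k" "z \<in> roots_of_unity k"
  shows "(\<Sum>j<k. inverse (of_nat k) * inverse z ^ j * x ^ j) = (if x = z then 1 else 0)"
proof -
  have "k > 0" using assms(1) by (cases k) auto
  have z: "z \<noteq> 0" using assms(3) \<open>k > 0\<close> by (auto simp: roots_of_unity_def power_0_left)
  have "(\<Sum>j<k. inverse (of_nat k) * inverse z ^ j * x ^ j) = inverse (of_nat k) * (\<Sum>j<k. (x / z) ^ j)"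
    by (simp add: sum_distrib_left power_mult_distrib[symmetric] divide_inverse mult_ac)
  also have "\<dots> = (if x = z then 1 else 0)"
  proof (cases "x = z")
    case True
    then show ?thesis using z assms(1) by simp
  next
    case False
    then have "x / z \<noteq> 1" using z by simp
    moreover have "(x / z) ^ k = 1" using assms by (simp add: roots_of_unity_def power_divide)
    ultimately show ?thesis using False by (simp add: geometric_sum)
  qed
  finally show ?thesis .
qed

section \<open>Functions on tuples of roots of unity as combinations of reduced monomials\<close>

definition reduced_monomials :: "nat \<Rightarrow> 'v set \<Rightarrow> ('v \<Rightarrow> nat) set" where
  "reduced_monomials k W = {a. (\<forall>v. a v < k) \<and> (\<forall>v. v \<notin> W \<longrightarrow> a v = 0)}"

lemma finite_reduced_monomials:
  assumes "finite W"
  shows "finite (reduced_monomials k W)"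
proof -
  have "inj_on (\<lambda>a. restrict a W) (reduced_monomials k W)"
  proof (intro inj_onI ext)
    fix a b v
    assume h: "a \<in> reduced_monomials k W" "b \<in> reduced_monomials k W" "restrict a W = restrict b W"
    show "a v = b v"
      using h(1,2) fun_cong[OF h(3), of v] by (cases "v \<in> W") (auto simp: reduced_monomials_def)
  qed
  moreover have "(\<lambda>a. restrict a W) ` reduced_monomials k W \<subseteq> PiE W (\<lambda>_. {..<k})"
    by (auto simp: reduced_monomials_def)
  ultimately show ?thesis
    using assms by (meson finite_PiE finite_imageD finite_lessThan finite_subset)
qed

lemma reduced_monomials_mono: "U \<subseteq> W \<Longrightarrow> reduced_monomials k U \<subseteq> reduced_monomials k W"
  by (auto simp: reduced_monomials_def)

definition eval_monomial :: "'v set \<Rightarrow> ('v \<Rightarrow> 'k::comm_ring_1) \<Rightarrow> ('v \<Rightarrow> nat) \<Rightarrow> 'k" where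
  "eval_monomial V x a = (\<Prod>v\<in>V. x v ^ a v)"

text \<open>Polynomials modulo those vanishing on \<open>X\<close> are treated as functions on
  \<open>X\<close>, so that no ideals are needed.\<close>

definition spanned :: "'v set \<Rightarrow> ('v \<Rightarrow> nat) set \<Rightarrow> ('v \<Rightarrow> 'k::comm_ring_1) set \<Rightarrow> (('v \<Rightarrow> 'k) \<Rightarrow> 'k) \<Rightarrow> bool" where
  "spanned V A X h \<longleftrightarrow> (\<exists>g. \<forall>x\<in>X. h x = (\<Sum>a\<in>A. g a * eval_monomial V x a))"

lemma spanned_cong:
  assumes "spanned V A X h" "\<And>x. x \<in> X \<Longrightarrow> h' x = h x"
  shows "spanned V A X h'"
  using assms unfolding spanned_def by simp

lemma spanned_eval_monomial:
  assumes "finite A" "a \<in> A"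
  shows "spanned V A X (\<lambda>x. eval_monomial V x a)"
  unfolding spanned_def
proof (intro exI[of _ "\<lambda>b. if b = a then 1 else 0"] ballI)
  fix x :: "'a \<Rightarrow> 'b"
  show "eval_monomial V x a = (\<Sum>b\<in>A. (if b = a then 1 else 0) * eval_monomial V x b)"
    using assms by (simp add: if_distrib[of "\<lambda>t. t * _"] sum.delta cong: if_cong)
qed

lemma spanned_mult: "spanned V A X h \<Longrightarrow> spanned V A X (\<lambda>x. t * h x)"
  unfolding spanned_def
  by (elim exE, rule_tac x = "\<lambda>a. t * g a" in exI) (simp add: sum_distrib_left mult.assoc)

lemma spanned_add: "spanned V A X h \<Longrightarrow> spanned V A X h' \<Longrightarrow> spanned V A X (\<lambda>x. h x + h' x)"
  unfolding spanned_def
  by (elim exE, rule_tac x = "\<lambda>a. g a + ga a" in exI) (simp add: sum.distrib algebra_simps)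

lemma spanned_sum:
  assumes "\<And>i. i \<in> I \<Longrightarrow> spanned V A X (h i)"
  shows "spanned V A X (\<lambda>x. \<Sum>i\<in>I. h i x)"
  using assms
proof (induction I rule: infinite_finite_induct)
  case (insert i I)
  then show ?case by (simp add: spanned_add)
qed (auto simp: spanned_def intro!: exI[of _ "\<lambda>_. 0"])

text \<open>Interpolation: \<open>h\<close> is the sum over all tuples \<open>t\<close> of roots on
  \<open>T\<close> of \<open>h t\<close> times the indicator of \<open>t\<close>, and this indicator
  is a product of one-variable indicators.\<close>

lemma spanned_local_function:
  fixes h :: "('v \<Rightarrow> 'k::field) \<Rightarrow> 'k"
  assumes "finite V" "T \<subseteq> V" "of_nat k \<noteq> (0 :: 'k)"
    and local: "\<And>x y. (\<And>v. v \<in> T \<Longrightarrow> x v = y v) \<Longrightarrow> h x = h y"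
  shows "spanned V (reduced_monomials k T) {x. \<forall>v\<in>T. x v \<in> roots_of_unity k} h"
proof -
  have "k > 0" using assms(3) by (cases k) auto
  have "finite T" using assms finite_subset by blast
  define P where "P = PiE T (\<lambda>_. roots_of_unity k :: 'k set)"
  have "finite P" unfolding P_def
    by (intro finite_PiE \<open>finite T\<close> finite_roots_of_unity \<open>k > 0\<close>)
  define coef :: "'k \<Rightarrow> nat \<Rightarrow> 'k" where "coef z j = inverse (of_nat k) * inverse z ^ j" for z j
  define ext :: "('v \<Rightarrow> nat) \<Rightarrow> 'v \<Rightarrow> nat" where "ext b v = (if v \<in> T then b v else 0)" for b v
  have ext: "ext b \<in> reduced_monomials k T" if "b \<in> PiE T (\<lambda>_. {..<k})" for b
    using that \<open>k > 0\<close> by (auto simp: reduced_monomials_def ext_def PiE_def Pi_def)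
  have eval_ext: "eval_monomial V x (ext b) = (\<Prod>v\<in>T. x v ^ b v)" for x :: "'v \<Rightarrow> 'k" and b
    unfolding eval_monomial_def
    by (rule prod.mono_neutral_cong_right) (use assms in \<open>auto simp: ext_def\<close>)
  have "spanned V (reduced_monomials k T) {x. \<forall>v\<in>T. x v \<in> roots_of_unity k}
      (\<lambda>x. \<Sum>t\<in>P. h t * (\<Sum>b\<in>PiE T (\<lambda>_. {..<k}). (\<Prod>v\<in>T. coef (t v) (b v)) * eval_monomial V x (ext b)))"
    by (intro spanned_sum spanned_mult spanned_eval_monomial ext
        finite_reduced_monomials \<open>finite T\<close>)
  then show ?thesis
  proof (rule spanned_cong)
    fix x :: "'v \<Rightarrow> 'k"
    assume x: "x \<in> {x. \<forall>v\<in>T. x v \<in> roots_of_unity k}"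
    have indicator: "(\<Sum>b\<in>PiE T (\<lambda>_. {..<k}). (\<Prod>v\<in>T. coef (t v) (b v)) * eval_monomial V x (ext b))
        = (if t = restrict x T then 1 else 0)" if t: "t \<in> P" for t
    proof -
      have "(\<Sum>b\<in>PiE T (\<lambda>_. {..<k}). (\<Prod>v\<in>T. coef (t v) (b v)) * eval_monomial V x (ext b))
          = (\<Sum>b\<in>PiE T (\<lambda>_. {..<k}). \<Prod>v\<in>T. coef (t v) (b v) * x v ^ b v)"
        by (simp add: eval_ext prod.distrib)
      also have "\<dots> = (\<Prod>v\<in>T. \<Sum>j<k. coef (t v) j * x v ^ j)"
        by (rule prod_sum_PiE[symmetric]) (use \<open>finite T\<close> in auto)
      also have "\<dots> = (\<Prod>v\<in>T. if x v = t v then 1 else 0)"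
        unfolding coef_def
        by (intro prod.cong roots_of_unity_indicator assms(3)) (use x t in \<open>auto simp: P_def\<close>)
      also have "\<dots> = (if \<forall>v\<in>T. x v = t v then 1 else 0)"
        using \<open>finite T\<close> by (auto simp: prod_zero_iff)
      also have "(\<forall>v\<in>T. x v = t v) \<longleftrightarrow> t = restrict x T"
        using t by (auto simp: P_def PiE_def extensional_def fun_eq_iff)
      finally show ?thesis .
    qed
    have "restrict x T \<in> P" using x by (auto simp: P_def)
    then show "h x = (\<Sum>t\<in>P. h t * (\<Sum>b\<in>PiE T (\<lambda>_. {..<k}).
        (\<Prod>v\<in>T. coef (t v) (b v)) * eval_monomial V x (ext b)))"
      using \<open>finite P\<close> local[of x "restrict x T"]
      by (simp add: indicator if_distrib sum.delta' cong: if_cong)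
  qed
qed

text \<open>Digits in base \<open>k\<close> at distinct positions below \<open>n\<close>. The digit
  at the top position, if present, is split off; it is at most \<open>k - 1\<close>, and the rest is
  smaller than one unit there.\<close>

lemma base_digits_less:
  fixes a idx :: "'v \<Rightarrow> nat"
  assumes "finite T" "inj_on idx T" "\<And>v. v \<in> T \<Longrightarrow> idx v < n" "\<And>v. v \<in> T \<Longrightarrow> a v < k"
    and "k > 0"
  shows "(\<Sum>v\<in>T. a v * k ^ idx v) < k ^ n"
  using assms
proof (induction n arbitrary: T)
  case 0
  then show ?case by (metis equals0I not_less_zero power_0 sum.empty zero_less_one)
next
  case (Suc n)
  show ?case
  proof (cases "n \<in> idx ` T")
    case True
    then obtain w where w: "w \<in> T" "idx w = n" by blast
    have "idx v < n" if "v \<in> T - {w}" for v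
      using that w Suc.prems(2,3) by (metis DiffD1 DiffD2 inj_onD insertI1 less_antisym)
    then have "(\<Sum>v\<in>T - {w}. a v * k ^ idx v) < k ^ n"
      using Suc.prems by (intro Suc.IH) (auto intro: inj_on_subset)
    moreover have "a w * k ^ n + k ^ n \<le> k ^ Suc n"
      using mult_le_mono1[of "Suc (a w)" k "k ^ n"] Suc.prems(4)[OF w(1)] by simp
    moreover have "(\<Sum>v\<in>T. a v * k ^ idx v) = a w * k ^ n + (\<Sum>v\<in>T - {w}. a v * k ^ idx v)"
      using sum.remove[OF Suc.prems(1) w(1), of "\<lambda>v. a v * k ^ idx v"] w(2) by simp
    ultimately show ?thesis by linarith
  next
    case False
    then have "idx v < n" if "v \<in> T" for v
      using that Suc.prems(3) by (metis imageI less_antisym)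
    then have "(\<Sum>v\<in>T. a v * k ^ idx v) < k ^ n"
      using Suc.prems by (intro Suc.IH) auto
    also have "k ^ n \<le> k ^ Suc n" using \<open>k > 0\<close> by simp
    finally show ?thesis .
  qed
qed

section \<open>Lexicographic reduction\<close>

text \<open>The order \<open>idx\<close> of the variables refines \<open>c\<close>, so that edges
  descending for \<open>c\<close> lead to preceding vertices. Three roots ensure that two given
  colours can always be avoided.\<close>

locale reduction =
  fixes V :: "'v set" and E :: "'v set set" and c :: "'v \<Rightarrow> nat" and idx :: "'v \<Rightarrow> nat" and k :: nat
    and K :: "'k::field itself"
  assumes finite_V: "finite V"
    and edge_V: "{u, v} \<in> E \<Longrightarrow> u \<in> V"
    and c_neq: "{u, v} \<in> E \<Longrightarrow> c u \<noteq> c v"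
    and idx_inj: "inj_on idx V"
    and idx_less: "u \<in> V \<Longrightarrow> v \<in> V \<Longrightarrow> c u < c v \<Longrightarrow> idx u < idx v"
    and k_nz: "of_nat k \<noteq> (0 :: 'k)"
    and three_roots: "card (roots_of_unity k :: 'k set) \<ge> 3"
begin

abbreviation Z :: "'k set" where "Z \<equiv> roots_of_unity k"

abbreviation "M \<equiv> reduced_monomials k"

abbreviation ev :: "('v \<Rightarrow> 'k) \<Rightarrow> ('v \<Rightarrow> nat) \<Rightarrow> 'k" where "ev \<equiv> eval_monomial V"

text \<open>The lexicographic order, with the vertex of largest \<open>idx\<close> most significant,
  encoded as a number in base \<open>k\<close>. Recursion and induction on monomials then run over
  natural numbers.\<close>

definition code :: "('v \<Rightarrow> nat) \<Rightarrow> nat" where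
  "code a = (\<Sum>v\<in>V. a v * k ^ idx v)"

definition colourings :: "'v set \<Rightarrow> ('v \<Rightarrow> 'k) set" where
  "colourings W = {x. (\<forall>v\<in>W. x v \<in> Z) \<and> (\<forall>u\<in>W. \<forall>v\<in>W. {u, v} \<in> E \<longrightarrow> x u \<noteq> x v)}"

lemma k_pos: "k > 0" using k_nz by (cases k) auto

text \<open>The digits above \<open>z\<close> agree, and those below \<open>z\<close> add up to less
  than one unit at the position of \<open>z\<close>.\<close>

lemma code_less:
  assumes "a \<in> M V" "b \<in> M V" "z \<in> V" "a z < b z"
    and agree: "\<And>v. v \<in> V \<Longrightarrow> idx z < idx v \<Longrightarrow> a v = b v"
  shows "code a < code b"
proof -
  define L where "L = {v \<in> V. idx v < idx z}"
  define H where "H = {v \<in> V. idx z < idx v}"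
  have "V = insert z (L \<union> H)"
    using assms(3) idx_inj by (auto simp: L_def H_def inj_on_def) (metis linorder_neqE_nat)
  moreover have "z \<notin> L \<union> H" "L \<inter> H = {}" "finite L" "finite H"
    using finite_V by (auto simp: L_def H_def)
  ultimately have split: "code g = g z * k ^ idx z + (\<Sum>v\<in>L. g v * k ^ idx v) + (\<Sum>v\<in>H. g v * k ^ idx v)" for g
    unfolding code_def by (simp add: sum.union_disjoint)
  have "(\<Sum>v\<in>L. a v * k ^ idx v) < k ^ idx z"
    using \<open>finite L\<close> idx_inj assms(1) k_pos
    by (intro base_digits_less) (auto simp: L_def reduced_monomials_def inj_on_def)
  moreover have "(\<Sum>v\<in>H. a v * k ^ idx v) = (\<Sum>v\<in>H. b v * k ^ idx v)"
    using agree by (intro sum.cong) (auto simp: H_def)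
  moreover have "a z * k ^ idx z + k ^ idx z \<le> b z * k ^ idx z"
    using mult_le_mono1[of "Suc (a z)" "b z" "k ^ idx z"] assms(4) by simp
  ultimately show ?thesis unfolding split by linarith
qed

lemma top_difference:
  assumes "a \<in> M V" "b \<in> M V" "a \<noteq> b"
  shows "\<exists>z\<in>V. a z \<noteq> b z \<and> (\<forall>v\<in>V. idx z < idx v \<longrightarrow> a v = b v)"
proof -
  define D where "D = {v \<in> V. a v \<noteq> b v}"
  have "finite D" using finite_V by (simp add: D_def)
  moreover obtain v where "a v \<noteq> b v" using assms(3) by blast
  then have "v \<in> D" using assms(1,2) by (cases "v \<in> V") (auto simp: D_def reduced_monomials_def)
  ultimately have max: "Max (idx ` D) \<in> idx ` D" by (intro Max_in) auto
  then obtain z where z: "z \<in> D" "idx z = Max (idx ` D)" by auto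
  have "a v = b v" if "v \<in> V" "idx z < idx v" for v
  proof (rule ccontr)
    assume "a v \<noteq> b v"
    then have "idx v \<le> Max (idx ` D)" using that \<open>finite D\<close> by (intro Max_ge) (auto simp: D_def)
    then show False using that z by simp
  qed
  then show ?thesis using z by (auto simp: D_def)
qed

lemma code_lessD:
  assumes "a \<in> M V" "b \<in> M V" "code a < code b"
  shows "\<exists>z\<in>V. a z < b z \<and> (\<forall>v\<in>V. idx z < idx v \<longrightarrow> a v = b v)"
proof -
  have "a \<noteq> b" using assms(3) by auto
  obtain z where z: "z \<in> V" "a z \<noteq> b z" "\<And>v. v \<in> V \<Longrightarrow> idx z < idx v \<Longrightarrow> a v = b v"
    using top_difference[OF assms(1,2) \<open>a \<noteq> b\<close>] by blast
  have "\<not> b z < a z" using code_less[OF assms(2,1) z(1)] z(3) assms(3) by fastforce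
  then show ?thesis using z by force
qed

lemma code_inj: "inj_on code (M V)"
proof (rule inj_onI, rule ccontr)
  fix a b assume h: "a \<in> M V" "b \<in> M V" "code a = code b" "a \<noteq> b"
  obtain z where z: "z \<in> V" "a z \<noteq> b z" "\<And>v. v \<in> V \<Longrightarrow> idx z < idx v \<Longrightarrow> a v = b v"
    using top_difference[OF h(1,2,4)] by blast
  have "code a < code b \<or> code b < code a"
  proof (cases "a z < b z")
    case True
    then show ?thesis using code_less[OF h(1,2) z(1)] z(3) by blast
  next
    case False
    then have "b z < a z" using z(2) by simp
    then show ?thesis using code_less[OF h(2,1) z(1)] z(3) by force
  qed
  then show False using h(3) by simp
qed

text \<open>For a reduced monomial over \<open>W\<close>: being the leading monomial of a polynomial
  in the variables of \<open>W\<close> that vanishes on \<open>colourings W\<close>.\<close>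

definition reducible :: "'v set \<Rightarrow> ('v \<Rightarrow> nat) \<Rightarrow> bool" where
  "reducible W m \<longleftrightarrow> spanned V {a \<in> M W. code a < code m} (colourings W) (\<lambda>x. ev x m)"

text \<open>Substituting the extension \<open>e y\<close> into a relation on \<open>W\<close> gives
  one on \<open>U\<close>. In a monomial \<open>a\<close> below \<open>m\<close>, let
  \<open>z\<close> be the highest vertex of difference. The variables above \<open>z\<close> occur
  as in \<open>m\<close>, hence lie in \<open>U\<close> if they occur. The part below
  \<open>z\<close> becomes a function of the vertices of \<open>U\<close> preceding \<open>z\<close>
  and is rewritten in reduced monomials there, so everything stays below \<open>m\<close>.\<close>

lemma reducible_restrict:
  assumes "U \<subseteq> W" "W \<subseteq> V" "m \<in> M U" "reducible W m"
    and e: "\<And>y. y \<in> colourings U \<Longrightarrow> e y \<in> colourings W"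
    and e_U: "\<And>y v. v \<in> U \<Longrightarrow> e y v = y v"
    and e_local: "\<And>y y' w. w \<in> W - U \<Longrightarrow> (\<And>u. u \<in> U \<Longrightarrow> idx u < idx w \<Longrightarrow> y u = y' u) \<Longrightarrow> e y w = e y' w"
  shows "reducible U m"
proof -
  have mV: "m \<in> M V" using assms reduced_monomials_mono by (meson order_trans subsetD)
  obtain g where g: "\<And>x. x \<in> colourings W \<Longrightarrow> ev x m = (\<Sum>a\<in>{a \<in> M W. code a < code m}. g a * ev x a)"
    using assms(4) unfolding reducible_def spanned_def by blast
  have fin: "finite {a \<in> M U. code a < code m}"
    using assms finite_V by (intro finite_subset[OF _ finite_reduced_monomials[of U k]])
      (auto intro: finite_subset)
  have "spanned V {a \<in> M U. code a < code m} (colourings U) (\<lambda>y. ev (e y) a)"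
    if a: "a \<in> M W" "code a < code m" for a
  proof -
    have aV: "a \<in> M V" using a assms(2) reduced_monomials_mono by blast
    obtain z where z: "z \<in> V" "a z < m z" "\<And>v. v \<in> V \<Longrightarrow> idx z < idx v \<Longrightarrow> a v = m v"
      using code_lessD[OF aV mV a(2)] by blast
    \<comment> \<open>A positive exponent in \<open>m\<close> occurs only on
      \<open>U\<close>.\<close>
    have zU: "z \<in> U" using z(2) assms(3) by (auto simp: reduced_monomials_def)
    define T where "T = {u \<in> U. idx u < idx z}"
    define L where "L = {v \<in> V. idx v < idx z}"
    define h where "h y = (\<Prod>v\<in>L. e y v ^ a v)" for y
    have "spanned V (M T) {y. \<forall>v\<in>T. y v \<in> Z} h"
    proof (rule spanned_local_function[OF finite_V _ k_nz])
      show "T \<subseteq> V" using assms by (auto simp: T_def)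
    next
      fix x y :: "'v \<Rightarrow> 'k" assume xy: "\<And>v. v \<in> T \<Longrightarrow> x v = y v"
      show "h x = h y"
        unfolding h_def
      proof (rule prod.cong[OF refl])
        fix v assume v: "v \<in> L"
        consider "v \<in> U" | "v \<in> W - U" | "v \<notin> W" by blast
        then show "e x v ^ a v = e y v ^ a v"
        proof cases
          case 1
          then show ?thesis using v xy by (simp add: e_U T_def L_def)
        next
          case 2
          have "e x v = e y v" by (rule e_local[OF 2]) (use v xy in \<open>auto simp: T_def L_def\<close>)
          then show ?thesis by simp
        next
          case 3
          then show ?thesis using a by (simp add: reduced_monomials_def)
        qed
      qed
    qed
    then obtain q where q: "\<And>y. y \<in> colourings U \<Longrightarrow> h y = (\<Sum>b\<in>M T. q b * ev y b)"
      unfolding spanned_def colourings_def T_def by auto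
    \<comment> \<open>The exponents of \<open>m\<close> above \<open>z\<close>, of \<open>a\<close>
      at \<open>z\<close> and of \<open>b\<close> below. The smaller exponent at \<open>z\<close>
      keeps the monomial below \<open>m\<close>.\<close>
    define join where "join b v = (if v \<in> V \<and> idx z < idx v then m v else if v = z then a z else b v)" for b v
    have join: "join b \<in> {a \<in> M U. code a < code m}" if b: "b \<in> M T" for b
    proof -
      have "join b \<in> M U"
        using b a zU assms(3) k_pos by (auto simp: join_def reduced_monomials_def T_def)
      moreover from this have "join b \<in> M V" using assms reduced_monomials_mono by (meson order_trans subsetD)
      then have "code (join b) < code m"
        by (rule code_less[OF _ mV z(1)]) (use z in \<open>auto simp: join_def\<close>)
      ultimately show ?thesis by blast
    qed
    define H where "H = {v \<in> V. idx z < idx v}"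
    have V_split: "V = insert z (L \<union> H)"
      using z(1) idx_inj by (auto simp: L_def H_def inj_on_def) (metis linorder_neqE_nat)
    have LH: "z \<notin> L \<union> H" "L \<inter> H = {}" "finite L" "finite H"
      using finite_V by (auto simp: L_def H_def)
    have ev_split: "ev x b = x z ^ b z * ((\<Prod>v\<in>L. x v ^ b v) * (\<Prod>v\<in>H. x v ^ b v))" for x b
      unfolding eval_monomial_def by (subst V_split) (use LH in \<open>simp add: prod.union_disjoint\<close>)
    have ev_e: "ev (e y) a = (\<Sum>b\<in>M T. q b * ev y (join b))" if y: "y \<in> colourings U" for y
    proof -
      have high: "(\<Prod>v\<in>H. e y v ^ a v) = (\<Prod>v\<in>H. y v ^ m v)"
      proof (rule prod.cong[OF refl])
        fix v assume "v \<in> H"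
        then have "a v = m v" using z(3) by (simp add: H_def)
        then show "e y v ^ a v = y v ^ m v"
          using e_U[of v y] assms(3) by (cases "v \<in> U") (auto simp: reduced_monomials_def)
      qed
      have "ev (e y) a = y z ^ a z * (h y * (\<Prod>v\<in>H. y v ^ m v))"
        unfolding ev_split h_def high using e_U[OF zU] by simp
      also have "\<dots> = (\<Sum>b\<in>M T. q b * (y z ^ a z * (ev y b * (\<Prod>v\<in>H. y v ^ m v))))"
        by (simp add: q[OF y] sum_distrib_left sum_distrib_right mult_ac)
      also have "\<dots> = (\<Sum>b\<in>M T. q b * ev y (join b))"
      proof (rule sum.cong[OF refl])
        fix b assume b: "b \<in> M T"
        have "b v = 0" if "v \<in> insert z H" for v
          using b that by (auto simp: reduced_monomials_def T_def H_def)
        then have "ev y b = (\<Prod>v\<in>L. y v ^ b v)" unfolding ev_split by simp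
        moreover have "(\<Prod>v\<in>L. y v ^ join b v) = (\<Prod>v\<in>L. y v ^ b v)"
          by (intro prod.cong) (auto simp: join_def L_def)
        moreover have "(\<Prod>v\<in>H. y v ^ join b v) = (\<Prod>v\<in>H. y v ^ m v)"
          by (intro prod.cong) (auto simp: join_def H_def)
        moreover have "join b z = a z" by (simp add: join_def)
        ultimately show "q b * (y z ^ a z * (ev y b * (\<Prod>v\<in>H. y v ^ m v))) = q b * ev y (join b)"
          unfolding ev_split[of y "join b"] by simp
      qed
      finally show ?thesis .
    qed
    show ?thesis
      by (rule spanned_cong[OF spanned_sum[OF spanned_mult[OF spanned_eval_monomial[OF fin join]]] ev_e])
  qed
  then have "spanned V {a \<in> M U. code a < code m} (colourings U)
      (\<lambda>y. \<Sum>a\<in>{a \<in> M W. code a < code m}. g a * ev (e y) a)"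
    by (intro spanned_sum spanned_mult) auto
  then have "spanned V {a \<in> M U. code a < code m} (colourings U) (\<lambda>y. ev y m)"
  proof (rule spanned_cong)
    fix y assume y: "y \<in> colourings U"
    have "ev y m = ev (e y) m"
      unfolding eval_monomial_def
    proof (rule prod.cong[OF refl])
      fix v
      show "y v ^ m v = e y v ^ m v"
        using e_U[of v y] assms(3) by (cases "v \<in> U") (auto simp: reduced_monomials_def)
    qed
    then show "ev y m = (\<Sum>a\<in>{a \<in> M W. code a < code m}. g a * ev (e y) a)"
      using g[OF e[OF y]] by simp
  qed
  then show ?thesis by (simp add: reducible_def)
qed

section \<open>Extending colourings from a path-closed set to a larger bipartite set\<close>

lemma edge_V2: "{u, v} \<in> E \<Longrightarrow> v \<in> V"
  using edge_V[of v u] by (simp add: insert_commute)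

lemma two_roots_avoid: "\<exists>z\<in>Z. z \<noteq> a \<and> z \<noteq> b"
proof (rule ccontr)
  assume "\<not> ?thesis"
  then have "Z \<subseteq> {a, b}" by blast
  then have "card Z \<le> card {a, b}" by (intro card_mono) auto
  also have "\<dots> \<le> 2" by (simp add: card_insert_if)
  finally show False using three_roots by simp
qed

text \<open>Colour \<open>W - U\<close> by two fixed colours, then recolour each neighbour \<open>w\<close> of \<open>U\<close>: only the colour
  of its neighbour in \<open>U\<close>, which precedes \<open>w\<close>, and one fixed colour have to be avoided.\<close>

lemma colouring_extension:
  assumes closed: "path_closed E c U" and "U \<subseteq> W" "W \<subseteq> V" and \<chi>: "two_colouring E W \<chi>"
  obtains e where "\<And>y. y \<in> colourings U \<Longrightarrow> e y \<in> colourings W"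
    "\<And>y v. v \<in> U \<Longrightarrow> e y v = y v"
    "\<And>y y' w. w \<in> W - U \<Longrightarrow> (\<And>u. u \<in> U \<Longrightarrow> idx u < idx w \<Longrightarrow> y u = y' u) \<Longrightarrow> e y w = e y' w"
proof -
  obtain r s where rs: "r \<in> Z" "s \<in> Z" "r \<noteq> s" using two_roots_avoid by metis
  define base where "base b = (if b then r else s)" for b
  define pick where "pick a b = (SOME z. z \<in> Z \<and> z \<noteq> a \<and> z \<noteq> b)" for a b
  have pick: "pick a b \<in> Z" "pick a b \<noteq> a" "pick a b \<noteq> b" for a b
    using someI_ex[of "\<lambda>z. z \<in> Z \<and> z \<noteq> a \<and> z \<noteq> b"] two_roots_avoid unfolding pick_def by blast+
  define att where "att u w \<longleftrightarrow> u \<in> U \<and> {u, w} \<in> E" for u w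
  define the_att where "the_att w = (SOME u. att u w)" for w
  have the_att: "the_att w = u" if "att u w" "w \<notin> U" for u w
    using path_closed_unique[OF closed] someI[of "\<lambda>u. att u w", OF that(1)] that
    unfolding the_att_def att_def by blast
  \<comment> \<open>An unattached neighbour of an attached \<open>w\<close> outside \<open>U\<close>
    has colour \<open>base (\<not> \<chi> w)\<close>, which \<open>w\<close> avoids. Two attached
    vertices outside \<open>U\<close> are never adjacent, since \<open>U\<close> is
    path-closed.\<close>
  define e where "e y w = (if w \<in> U then y w
      else if \<exists>u. att u w then pick (y (the_att w)) (base (\<not> \<chi> w)) else base (\<chi> w))" for y w
  have "e y \<in> colourings W" if y: "y \<in> colourings U" for y
  proof -
    have e_Z: "e y v \<in> Z" if "v \<in> W" for v
      using y pick rs by (auto simp: e_def base_def colourings_def)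
    have e_att: "e y u \<noteq> e y w" if "att u w" "w \<notin> U" for u w
    proof -
      have "e y w = pick (y u) (base (\<not> \<chi> w))" using the_att[OF that] that by (auto simp: e_def)
      moreover have "e y u = y u" using that by (simp add: e_def att_def)
      ultimately show ?thesis using pick(2) by metis
    qed
    have e_out: "e y w \<noteq> e y w'"
      if w: "w \<in> W" "w' \<in> W" "w \<notin> U" "w' \<notin> U" "{w, w'} \<in> E" "\<nexists>u. att u w" for w w'
    proof -
      have "\<chi> w = (\<not> \<chi> w')" using w \<chi> by (auto simp: two_colouring_def)
      then have "e y w = base (\<not> \<chi> w')" using w by (simp add: e_def)
      moreover have "base (\<not> \<chi> w') \<noteq> base (\<chi> w')" using rs by (simp add: base_def)
      moreover have "e y w' = pick (y (the_att w')) (base (\<not> \<chi> w')) \<or> e y w' = base (\<chi> w')"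
        using w by (auto simp: e_def)
      ultimately show ?thesis using pick(3) by metis
    qed
    have "e y u \<noteq> e y w" if h: "u \<in> W" "w \<in> W" "{u, w} \<in> E" for u w
    proof -
      have h': "{w, u} \<in> E" using h by (simp add: insert_commute)
      consider "u \<in> U" "w \<in> U" | "att u w" "w \<notin> U" | "att w u" "u \<notin> U"
        | "u \<notin> U" "w \<notin> U" "\<nexists>v. att v u" | "u \<notin> U" "w \<notin> U" "\<nexists>v. att v w"
        | v v' where "u \<notin> U" "w \<notin> U" "att v u" "att v' w"
        using h h' unfolding att_def by blast
      then show ?thesis
      proof cases
        case 1
        then show ?thesis using y h by (simp add: e_def colourings_def)
      next
        case 2
        then show ?thesis by (rule e_att)
      next
        case 3
        then show ?thesis using e_att by metis
      next
        case 4
        then show ?thesis using e_out h by metis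
      next
        case 5
        then show ?thesis using e_out h h' by metis
      next
        case 6
        then show ?thesis using path_closed_no_hop[OF closed] h unfolding att_def by blast
      qed
    qed
    then show ?thesis using e_Z by (simp add: colourings_def)
  qed
  moreover have "e y v = y v" if "v \<in> U" for y v using that by (simp add: e_def)
  moreover have "e y w = e y' w"
    if w: "w \<in> W - U" and agree: "\<And>u. u \<in> U \<Longrightarrow> idx u < idx w \<Longrightarrow> y u = y' u" for y y' w
  proof (cases "\<exists>u. att u w")
    case True
    then obtain u where u: "att u w" by blast
    \<comment> \<open>Otherwise the edge would descend from \<open>u\<close> to \<open>w\<close>,
      and \<open>w\<close> would belong to \<open>U\<close>.\<close>
    have "c u < c w"
      using u w path_closed_descend[OF closed, of u w] c_neq[of u w] by (force simp: att_def)
    then have "idx u < idx w"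
      using idx_less u w \<open>W \<subseteq> V\<close> edge_V by (auto simp: att_def)
    then have "y u = y' u" using agree u by (simp add: att_def)
    then show ?thesis using the_att[OF u] w by (simp add: e_def)
  next
    case False
    then show ?thesis using w by (simp add: e_def)
  qed
  ultimately show ?thesis by (rule that)
qed

section \<open>The linear functional on reduced monomials\<close>

definition tractable :: "'v set \<Rightarrow> bool" where
  "tractable W \<longleftrightarrow> W \<subseteq> V \<and> path_closed E c W \<and> (\<exists>\<chi>. two_colouring E W \<chi>)"

definition support_closure :: "('v \<Rightarrow> nat) \<Rightarrow> 'v set" where
  "support_closure m = path_closure E c {v. m v \<noteq> 0}"

lemma path_closure_subset_V: "S \<subseteq> V \<Longrightarrow> path_closure E c S \<subseteq> V"
  by (intro path_closure_least path_closed_vertices edge_V)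

text \<open>The consistency statement: reducibility over a tractable \<open>W\<close> already holds
  over the support closure, which depends on \<open>m\<close> alone. Colourings extend from this
  closure to \<open>W\<close>, so \<open>reducible_restrict\<close> applies.\<close>

lemma reducible_support_closure:
  assumes "tractable W" "m \<in> M W" "reducible W m"
  shows "m \<in> M (support_closure m)" "support_closure m \<subseteq> W" "reducible (support_closure m) m"
proof -
  have closed: "path_closed E c (support_closure m)" unfolding support_closure_def by (rule path_closed_path_closure)
  have "{v. m v \<noteq> 0} \<subseteq> support_closure m" unfolding support_closure_def by (rule subset_path_closure)
  then show m: "m \<in> M (support_closure m)" using assms(2) by (auto simp: reduced_monomials_def)
  show sub: "support_closure m \<subseteq> W"
    unfolding support_closure_def using assms by (intro path_closure_least) (auto simp: tractable_def reduced_monomials_def)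
  obtain \<chi> where W: "W \<subseteq> V" "two_colouring E W \<chi>" using assms(1) by (auto simp: tractable_def)
  obtain e where e: "\<And>y. y \<in> colourings (support_closure m) \<Longrightarrow> e y \<in> colourings W"
    "\<And>y v. v \<in> support_closure m \<Longrightarrow> e y v = y v"
    "\<And>y y' w. w \<in> W - support_closure m \<Longrightarrow> (\<And>u. u \<in> support_closure m \<Longrightarrow> idx u < idx w \<Longrightarrow> y u = y' u) \<Longrightarrow> e y w = e y' w"
    using colouring_extension[OF closed sub W] by metis
  show "reducible (support_closure m) m"
    by (rule reducible_restrict[of "support_closure m" W m e, OF sub W(1) m assms(3)]) (fact e)+
qed

definition lower :: "('v \<Rightarrow> nat) \<Rightarrow> ('v \<Rightarrow> nat) set" where
  "lower m = {a \<in> M (support_closure m). code a < code m}"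

text \<open>One fixed choice of relation for each reducible \<open>m\<close>; for other
  \<open>m\<close> its value is arbitrary.\<close>

definition rewriting :: "('v \<Rightarrow> nat) \<Rightarrow> ('v \<Rightarrow> nat) \<Rightarrow> 'k" where
  "rewriting m = (SOME g. \<forall>x\<in>colourings (support_closure m). ev x m = (\<Sum>a\<in>lower m. g a * ev x a))"

lemma rewriting:
  assumes "reducible (support_closure m) m" "x \<in> colourings (support_closure m)"
  shows "ev x m = (\<Sum>a\<in>lower m. rewriting m a * ev x a)"
  using someI_ex[OF assms(1)[unfolded reducible_def spanned_def lower_def[symmetric]]] assms(2)
  unfolding rewriting_def by blast

text \<open>The constant monomial has empty support closure and code 0, so a relation would have no
  lower terms and would say \<open>1 = 0\<close>.\<close>

lemma not_reducible_one: "\<not> reducible (support_closure (\<lambda>_. 0)) (\<lambda>_. 0)"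
proof
  assume "reducible (support_closure (\<lambda>_. 0)) (\<lambda>_. 0)"
  moreover have "path_closed E c {}" by (simp add: path_closed_def)
  then have "support_closure (\<lambda>_. 0) = {}"
    using path_closure_least[of "{}" "{}" E c] by (simp add: support_closure_def)
  ultimately have "ev x (\<lambda>_. 0) = 0" for x
    using rewriting[of "\<lambda>_. 0" x] by (simp add: lower_def code_def colourings_def)
  then show False by (simp add: eval_monomial_def)
qed

text \<open>Well-founded recursion on \<open>code\<close>, since a rewriting involves only monomials
  of smaller code. Every irreducible monomial is given the value 1; this normalises the functional
  at the constant monomial.\<close>

lemma functional_exists:
  obtains \<Lambda> :: "('v \<Rightarrow> nat) \<Rightarrow> 'k" where "\<Lambda> (\<lambda>_. 0) = 1"
    "\<And>m. reducible (support_closure m) m \<Longrightarrow> \<Lambda> m = (\<Sum>a\<in>lower m. rewriting m a * \<Lambda> a)"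
proof -
  define F :: "(('v \<Rightarrow> nat) \<Rightarrow> 'k) \<Rightarrow> ('v \<Rightarrow> nat) \<Rightarrow> 'k" where
    "F \<Lambda> m = (if reducible (support_closure m) m then \<Sum>a\<in>lower m. rewriting m a * \<Lambda> a else 1)" for \<Lambda> m
  have "adm_wf (measure code) F"
    unfolding adm_wf_def F_def by (auto intro!: sum.cong simp: lower_def)
  then have "wfrec (measure code) F = F (wfrec (measure code) F)"
    by (intro wfrec_fixpoint) auto
  then obtain \<Lambda> where \<Lambda>: "\<Lambda> m = F \<Lambda> m" for m by (metis (no_types))
  show ?thesis
  proof (rule that)
    show "\<Lambda> (\<lambda>_. 0) = 1" using \<Lambda>[of "\<lambda>_. 0"] not_reducible_one by (simp add: F_def)
    show "\<Lambda> m = (\<Sum>a\<in>lower m. rewriting m a * \<Lambda> a)" if "reducible (support_closure m) m" for m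
      using \<Lambda>[of m] that by (simp add: F_def)
  qed
qed

text \<open>Induction on the leading monomial, which \<open>reducible_support_closure\<close> allows to cancel by a relation on a
  subset of \<open>W\<close>.\<close>

lemma functional_vanishes:
  assumes \<Lambda>: "\<And>m. reducible (support_closure m) m \<Longrightarrow> \<Lambda> m = (\<Sum>a\<in>lower m. rewriting m a * \<Lambda> a)"
    and W: "tractable W"
    and "\<And>x. x \<in> colourings W \<Longrightarrow> (\<Sum>a\<in>M W. f a * ev x a) = 0"
  shows "(\<Sum>a\<in>M W. f a * \<Lambda> a) = 0"
proof -
  have WV: "W \<subseteq> V" using W by (simp add: tractable_def)
  then have fin: "finite (M W)" using finite_V by (auto intro: finite_reduced_monomials finite_subset)
  have "(\<Sum>a\<in>M W. f a * \<Lambda> a) = 0"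
    if "\<And>a. a \<in> M W \<Longrightarrow> f a \<noteq> 0 \<Longrightarrow> code a < n"
      and "\<And>x. x \<in> colourings W \<Longrightarrow> (\<Sum>a\<in>M W. f a * ev x a) = 0" for n f
    using that
  proof (induction n arbitrary: f)
    case 0
    then show ?case by (intro sum.neutral) auto
  next
    case (Suc n)
    show ?case
    proof (cases "\<exists>m\<in>M W. f m \<noteq> 0 \<and> code m = n")
      case False
      then have "code a < n" if "a \<in> M W" "f a \<noteq> 0" for a
        using Suc.prems(1)[OF that] that by (metis less_antisym)
      then show ?thesis using Suc.IH Suc.prems(2) by blast
    next
      case True
      then obtain m where m: "m \<in> M W" "f m \<noteq> 0" "code m = n" by blast
      have low: "code a < n" if "a \<in> M W" "f a \<noteq> 0" "a \<noteq> m" for a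
      proof -
        have "a \<in> M V" "m \<in> M V" using that(1) m(1) reduced_monomials_mono[OF WV] by auto
        then have "code a \<noteq> code m" using that(3) code_inj by (metis inj_onD)
        then show ?thesis using Suc.prems(1)[OF that(1,2)] m(3) by simp
      qed
      \<comment> \<open>Solving the vanishing combination for its leading term.\<close>
      have "reducible W m"
        unfolding reducible_def spanned_def
      proof (intro exI[of _ "\<lambda>a. - f a / f m"] ballI)
        fix x assume x: "x \<in> colourings W"
        have "(\<Sum>a\<in>M W - {m}. f a * ev x a) = (\<Sum>a\<in>{a \<in> M W. code a < code m}. f a * ev x a)"
          using fin m low by (intro sum.mono_neutral_right) auto
        then have "f m * ev x m + (\<Sum>a\<in>{a \<in> M W. code a < code m}. f a * ev x a) = 0"
          using Suc.prems(2)[OF x] sum.remove[OF fin m(1), of "\<lambda>a. f a * ev x a"] by simp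
        then have "ev x m = - (\<Sum>a\<in>{a \<in> M W. code a < code m}. f a * ev x a) / f m"
          using m(2) by (simp add: eq_neg_iff_add_eq_0 field_simps)
        then show "ev x m = (\<Sum>a\<in>{a \<in> M W. code a < code m}. - f a / f m * ev x a)"
          by (simp add: sum_negf sum_divide_distrib)
      qed
      note red = reducible_support_closure[OF W m(1) this]
      define g where "g a = (if a = m then 1 else if a \<in> lower m then - rewriting m a else 0)" for a
      have lower_W: "lower m \<subseteq> M W" "m \<notin> lower m" "finite (lower m)"
        using reduced_monomials_mono[OF red(2)] fin by (auto simp: lower_def intro: finite_subset)
      have g_sum: "(\<Sum>a\<in>M W. g a * t a) = t m - (\<Sum>a\<in>lower m. rewriting m a * t a)" for t :: "_ \<Rightarrow> 'k"
      proof -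
        have "(\<Sum>a\<in>M W. g a * t a) = (\<Sum>a\<in>insert m (lower m). g a * t a)"
          using fin m lower_W by (intro sum.mono_neutral_right) (auto simp: g_def)
        also have "\<dots> = t m + (\<Sum>a\<in>lower m. g a * t a)"
          using lower_W by (simp add: g_def)
        also have "(\<Sum>a\<in>lower m. g a * t a) = (\<Sum>a\<in>lower m. - (rewriting m a * t a))"
          using lower_W by (intro sum.cong) (auto simp: g_def)
        finally show ?thesis by (simp add: sum_negf)
      qed
      \<comment> \<open>Subtracts \<open>f m\<close> times the chosen relation of \<open>m\<close>.
        This relation holds on \<open>colourings W\<close>, because colourings restrict to the
        support closure, and \<open>\<Lambda>\<close> annihilates it by its recursion
        equation.\<close>
      define f' where "f' a = f a - f m * g a" for a
      have f'_sum: "(\<Sum>a\<in>M W. f' a * t a) = (\<Sum>a\<in>M W. f a * t a) - f m * (\<Sum>a\<in>M W. g a * t a)" for t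
        by (simp add: f'_def left_diff_distrib sum_subtractf sum_distrib_left mult.assoc)
      have "(\<Sum>a\<in>M W. f' a * \<Lambda> a) = 0"
      proof (rule Suc.IH)
        fix a assume a: "a \<in> M W" "f' a \<noteq> 0"
        then have "a \<noteq> m" by (auto simp: f'_def g_def)
        with a have "f a \<noteq> 0 \<or> a \<in> lower m" by (auto simp: f'_def g_def split: if_splits)
        then show "code a < n" using low a \<open>a \<noteq> m\<close> m(3) by (auto simp: lower_def)
      next
        fix x assume x: "x \<in> colourings W"
        then have "x \<in> colourings (support_closure m)" using red(2) by (auto simp: colourings_def)
        then show "(\<Sum>a\<in>M W. f' a * ev x a) = 0"
          unfolding f'_sum g_sum using Suc.prems(2)[OF x] rewriting[OF red(3)] by simp
      qed
      then show ?thesis unfolding f'_sum g_sum using \<Lambda>[OF red(3)] by simp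
    qed
  qed
  from this[of f "Suc (Max (code ` M W))"] show ?thesis
    using assms(3) fin by (simp add: less_Suc_eq_le)
qed

text \<open>A version with repetitions: reduction modulo \<open>k\<close> may map different
  monomials to the same one, so multiplicities become coefficients.\<close>

lemma functional_vanishes_family:
  assumes \<Lambda>: "\<And>m. reducible (support_closure m) m \<Longrightarrow> \<Lambda> m = (\<Sum>a\<in>lower m. rewriting m a * \<Lambda> a)"
    and W: "tractable W" and I: "finite I" "\<And>i. i \<in> I \<Longrightarrow> a i \<in> M W"
    and zero: "\<And>x. x \<in> colourings W \<Longrightarrow> (\<Sum>i\<in>I. ev x (a i)) = 0"
  shows "(\<Sum>i\<in>I. \<Lambda> (a i)) = 0"
proof -
  have fin: "finite (M W)"
    using W finite_V by (auto simp: tractable_def intro: finite_reduced_monomials finite_subset)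
  have eq: "(\<Sum>b\<in>M W. of_nat (card {i \<in> I. a i = b}) * t b) = (\<Sum>i\<in>I. t (a i))" for t :: "_ \<Rightarrow> 'k"
    using sum.group[of I "M W" a "\<lambda>i. t (a i)"] I fin by (simp add: image_subset_iff)
  show ?thesis
    using functional_vanishes[OF \<Lambda> W, of "\<lambda>b. of_nat (card {i \<in> I. a i = b})"] zero
    unfolding eq by blast
qed

end

section \<open>The functional on polynomials\<close>

lemma sum_single_lookup: "p = (\<Sum>m\<in>Poly_Mapping.keys p. Poly_Mapping.single m (Poly_Mapping.lookup p m))"
  by (rule poly_mapping_eqI)
    (auto simp: lookup_sum lookup_single when_def in_keys_iff sum.delta' intro!: sum.neutral)

lemma Var_power: "Var u ^ j = Poly_Mapping.single (Poly_Mapping.single u j) (1 :: 'k::comm_ring_1)"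
  by (induction j) (simp_all add: Var_def mult_single flip: single_add)

lemma monomial_degree_le_total_degree:
  "m \<in> Poly_Mapping.keys p \<Longrightarrow> monomial_degree m \<le> total_degree p"
  unfolding total_degree_def by (intro Max_ge) auto

lemma card_keys_le_monomial_degree: "card (Poly_Mapping.keys m) \<le> monomial_degree m"
proof -
  have "card (Poly_Mapping.keys m) = (\<Sum>v\<in>Poly_Mapping.keys m. 1)" by simp
  also have "\<dots> \<le> monomial_degree m"
    unfolding monomial_degree_def by (intro sum_mono) (simp add: in_keys_iff Suc_leI)
  finally show ?thesis .
qed

lemma eval_monomial_add:
  "eval_monomial V x (\<lambda>v. a v + b v) = eval_monomial V x a * eval_monomial V x b"
  by (simp add: eval_monomial_def power_add prod.distrib)

lemma eval_monomial_single:
  assumes "finite V" "u \<in> V"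
  shows "eval_monomial V x (Poly_Mapping.lookup (Poly_Mapping.single u j)) = x u ^ j"
proof -
  have "x v ^ Poly_Mapping.lookup (Poly_Mapping.single u j) v = (if v = u then x v ^ j else 1)" for v
    by (simp add: lookup_single when_def)
  then show ?thesis using assms by (simp add: eval_monomial_def prod.delta)
qed

context reduction
begin

text \<open>Reduction modulo the vertex polynomials, under which the power \<open>k\<close> of a
  variable becomes 1.\<close>

definition residue :: "('v \<Rightarrow>\<^sub>0 nat) \<Rightarrow> 'v \<Rightarrow> nat" where
  "residue m v = Poly_Mapping.lookup m v mod k"

lemma residue_in: "Poly_Mapping.keys m \<subseteq> W \<Longrightarrow> residue m \<in> M W"
  using k_pos by (auto simp: reduced_monomials_def residue_def subset_iff simp flip: not_in_keys_iff_lookup_eq_zero)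
    (metis mod_0 not_in_keys_iff_lookup_eq_zero)

lemma ev_residue:
  assumes "x \<in> colourings W" "Poly_Mapping.keys m \<subseteq> W"
  shows "ev x (residue m) = ev x (Poly_Mapping.lookup m)"
  unfolding eval_monomial_def
proof (rule prod.cong[OF refl])
  fix v
  show "x v ^ residue m v = x v ^ Poly_Mapping.lookup m v"
  proof (cases "v \<in> W")
    case True
    then have "x v ^ k = 1" using assms(1) by (auto simp: colourings_def roots_of_unity_def)
    then have "x v ^ (k * (Poly_Mapping.lookup m v div k) + Poly_Mapping.lookup m v mod k)
        = x v ^ residue m v"
      by (simp only: power_add power_mult residue_def) simp
    then show ?thesis by simp
  next
    case False
    then have "Poly_Mapping.lookup m v = 0" using assms(2) by (auto simp: in_keys_iff)
    then show ?thesis by (simp add: residue_def)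
  qed
qed

definition extend_linearly :: "(('v \<Rightarrow> nat) \<Rightarrow> 'k) \<Rightarrow> ('v, 'k) mpoly \<Rightarrow> 'k" where
  "extend_linearly \<Lambda> p = (\<Sum>m\<in>Poly_Mapping.keys p. Poly_Mapping.lookup p m * \<Lambda> (residue m))"

lemma extend_linearly_superset:
  assumes "finite A" "Poly_Mapping.keys p \<subseteq> A"
  shows "extend_linearly \<Lambda> p = (\<Sum>m\<in>A. Poly_Mapping.lookup p m * \<Lambda> (residue m))"
  unfolding extend_linearly_def using assms
  by (intro sum.mono_neutral_left) (auto simp: in_keys_iff)

lemma extend_linearly_add:
  "extend_linearly \<Lambda> (p + q) = extend_linearly \<Lambda> p + extend_linearly \<Lambda> q"
proof -
  define A where "A = Poly_Mapping.keys p \<union> Poly_Mapping.keys q"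
  have A: "finite A" "Poly_Mapping.keys p \<subseteq> A" "Poly_Mapping.keys q \<subseteq> A" "Poly_Mapping.keys (p + q) \<subseteq> A"
    using keys_add[of p q] by (auto simp: A_def)
  show ?thesis
    by (simp add: extend_linearly_superset[OF A(1,2)] extend_linearly_superset[OF A(1,3)]
        extend_linearly_superset[OF A(1,4)] lookup_add distrib_right sum.distrib)
qed

lemma extend_linearly_zero: "extend_linearly \<Lambda> 0 = 0"
  by (simp add: extend_linearly_def)

lemma extend_linearly_sum: "extend_linearly \<Lambda> (\<Sum>i\<in>I. p i) = (\<Sum>i\<in>I. extend_linearly \<Lambda> (p i))"
  by (induction I rule: infinite_finite_induct) (simp_all add: extend_linearly_zero extend_linearly_add)

lemma extend_linearly_single: "extend_linearly \<Lambda> (Poly_Mapping.single m t) = t * \<Lambda> (residue m)"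
  by (simp add: extend_linearly_def)

lemma extend_linearly_mult:
  "extend_linearly \<Lambda> (p * q) =
    (\<Sum>m\<in>Poly_Mapping.keys p. extend_linearly \<Lambda> (Poly_Mapping.single m (Poly_Mapping.lookup p m) * q))"
  by (subst sum_single_lookup[of p]) (simp add: sum_distrib_right extend_linearly_sum)

text \<open>Multiplying a monomial by the power \<open>k\<close> of a variable leaves its residue
  unchanged, so the two terms of each product cancel.\<close>

lemma extend_linearly_vertex: "extend_linearly \<Lambda> (p * vertex_poly k u) = 0"
proof -
  have "extend_linearly \<Lambda> (Poly_Mapping.single m t * vertex_poly k u) = 0" for m t
  proof -
    have "Poly_Mapping.single m t * vertex_poly k u =
        Poly_Mapping.single (m + Poly_Mapping.single u k) t + Poly_Mapping.single m (- t)"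
      by (simp add: vertex_poly_def Var_power right_diff_distrib mult_single single_uminus)
    moreover have "residue (m + Poly_Mapping.single u k) = residue m"
      by (auto simp: residue_def lookup_add lookup_single when_def)
    ultimately show ?thesis by (simp add: extend_linearly_add extend_linearly_single)
  qed
  then show ?thesis by (subst extend_linearly_mult) simp
qed

text \<open>For a monomial \<open>m\<close> of \<open>p\<close>, the product with the edge
  polynomial involves only variables of the closure \<open>W\<close> of the support of
  \<open>m\<close> together with \<open>u\<close> and \<open>v\<close>. It vanishes on
  \<open>colourings W\<close>, where \<open>u\<close> and \<open>v\<close> carry different roots of
  unity, so the functional annihilates it.\<close>

lemma extend_linearly_edge:
  assumes \<Lambda>: "\<And>m. reducible (support_closure m) m \<Longrightarrow> \<Lambda> m = (\<Sum>a\<in>lower m. rewriting m a * \<Lambda> a)"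
    and uv: "{u, v} \<in> E"
    and tract: "\<And>m. m \<in> Poly_Mapping.keys p \<Longrightarrow>
      tractable (path_closure E c (insert u (insert v (Poly_Mapping.keys m))))"
  shows "extend_linearly \<Lambda> (p * edge_quotient k u v) = 0"
proof -
  have "extend_linearly \<Lambda> (Poly_Mapping.single m t * edge_quotient k u v) = 0"
    if "m \<in> Poly_Mapping.keys p" for m t
  proof -
    define W where "W = path_closure E c (insert u (insert v (Poly_Mapping.keys m)))"
    have W: "tractable W" using tract[OF that] by (simp add: W_def)
    then have "W \<subseteq> V" by (simp add: tractable_def)
    have sub: "u \<in> W" "v \<in> W" "Poly_Mapping.keys m \<subseteq> W"
      using subset_path_closure[of "insert u (insert v (Poly_Mapping.keys m))" E c]
      by (auto simp: W_def)
    define n where "n r = m + (Poly_Mapping.single u (k - 1 - r) + Poly_Mapping.single v r)" for r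
    have n_keys: "Poly_Mapping.keys (n r) \<subseteq> W" for r
      using sub keys_add[of m] keys_add[of "Poly_Mapping.single u (k - 1 - r)" "Poly_Mapping.single v r"]
      unfolding n_def by (fastforce split: if_splits)
    have "Poly_Mapping.single m t * edge_quotient k u v = (\<Sum>r<k. Poly_Mapping.single (n r) t)"
      by (simp add: edge_quotient_def Var_power sum_distrib_left mult_single n_def)
    then have "extend_linearly \<Lambda> (Poly_Mapping.single m t * edge_quotient k u v)
        = t * (\<Sum>r<k. \<Lambda> (residue (n r)))"
      by (simp add: extend_linearly_sum extend_linearly_single sum_distrib_left)
    also have "(\<Sum>r<k. \<Lambda> (residue (n r))) = 0"
    proof (rule functional_vanishes_family[OF \<Lambda> W])
      fix x assume x: "x \<in> colourings W"
      have "ev x (residue (n r)) = ev x (Poly_Mapping.lookup m) * (x u ^ (k - 1 - r) * x v ^ r)" for r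
      proof -
        have "Poly_Mapping.lookup (n r) = (\<lambda>w. Poly_Mapping.lookup m w +
            (Poly_Mapping.lookup (Poly_Mapping.single u (k - 1 - r)) w
              + Poly_Mapping.lookup (Poly_Mapping.single v r) w))"
          by (simp add: n_def lookup_add fun_eq_iff)
        then show ?thesis
          using sub \<open>W \<subseteq> V\<close>
          by (simp add: ev_residue[OF x n_keys] eval_monomial_add eval_monomial_single[OF finite_V] subset_iff)
      qed
      then have "(\<Sum>r<k. ev x (residue (n r)))
          = ev x (Poly_Mapping.lookup m) * (\<Sum>r<k. x u ^ (k - 1 - r) * x v ^ r)"
        by (simp add: sum_distrib_left)
      also have "(\<Sum>r<k. x u ^ (k - 1 - r) * x v ^ r) = 0"
      proof -
        have "x u \<in> Z" "x v \<in> Z" "x u \<noteq> x v"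
          using x sub uv by (auto simp: colourings_def)
        moreover have "x v ^ k - x u ^ k = (x v - x u) * (\<Sum>r<k. x u ^ (k - 1 - r) * x v ^ r)"
          using power_diff_sumr2[of "x v" k "x u"] by simp
        ultimately show ?thesis by (simp add: roots_of_unity_def)
      qed
      finally show "(\<Sum>r<k. ev x (residue (n r))) = 0" by simp
    qed (simp_all add: residue_in n_keys)
    finally show ?thesis by simp
  qed
  then show ?thesis by (subst extend_linearly_mult) simp
qed

text \<open>The functional sends the left-hand side of a certificate to 0 and the constant 1 to 1.
  The bound \<open>d + 2\<close> counts at most \<open>d\<close> variables of a monomial of degree
  at most \<open>d\<close> and the two ends of an edge.\<close>

lemma no_certificate:
  fixes r :: "'v \<Rightarrow> ('v, 'k) mpoly" and s :: "'v set \<Rightarrow> ('v, 'k) mpoly"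
  assumes edges: "\<And>e. e \<in> E \<Longrightarrow> card e = 2"
    and tract: "\<And>S. S \<subseteq> V \<Longrightarrow> card S \<le> d + 2 \<Longrightarrow> tractable (path_closure E c S)"
    and s: "\<And>e. e \<in> E \<Longrightarrow> s e \<in> polys_in V \<and> total_degree (s e) \<le> d"
  shows "(\<Sum>u\<in>V. r u * vertex_poly k u) + (\<Sum>e\<in>E. s e * edge_poly k e) \<noteq> 1"
proof
  assume cert: "(\<Sum>u\<in>V. r u * vertex_poly k u) + (\<Sum>e\<in>E. s e * edge_poly k e) = 1"
  obtain \<Lambda> where one: "\<Lambda> (\<lambda>_. 0) = 1"
    and \<Lambda>: "\<And>m. reducible (support_closure m) m \<Longrightarrow> \<Lambda> m = (\<Sum>a\<in>lower m. rewriting m a * \<Lambda> a)"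
    using functional_exists by blast
  have "extend_linearly \<Lambda> (s e * edge_poly k e) = 0" if e: "e \<in> E" for e
  proof -
    obtain u v where uv: "e = {u, v}" using edges[OF e] by (auto simp: card_2_iff)
    have "extend_linearly \<Lambda> (s e * edge_quotient k u v) = 0"
    proof (rule extend_linearly_edge[OF \<Lambda>])
      fix m assume m: "m \<in> Poly_Mapping.keys (s e)"
      have "card (Poly_Mapping.keys m) \<le> d"
        using card_keys_le_monomial_degree[of m] monomial_degree_le_total_degree[OF m] s[OF e] by linarith
      then have "card (insert u (insert v (Poly_Mapping.keys m))) \<le> d + 2"
        by (simp add: card_insert_if)
      moreover have "insert u (insert v (Poly_Mapping.keys m)) \<subseteq> V"
        using s[OF e] m e edge_V edge_V2 by (auto simp: polys_in_def uv)
      ultimately show "tractable (path_closure E c (insert u (insert v (Poly_Mapping.keys m))))"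
        by (intro tract)
    qed (use e uv in auto)
    then show ?thesis by (simp add: uv edge_poly_eq)
  qed
  then have "extend_linearly \<Lambda> 1 = 0"
    unfolding cert[symmetric]
    by (simp add: extend_linearly_add extend_linearly_sum extend_linearly_vertex)
  moreover have "residue 0 = (\<lambda>_. 0)" by (simp add: residue_def fun_eq_iff)
  then have "extend_linearly \<Lambda> 1 = 1"
    using extend_linearly_single[of \<Lambda> 0 1] one by simp
  ultimately show False by simp
qed

end

section \<open>Choice of the colouring and the order, and the theorem\<close>

lemma proper_coloring_chromatic_number:
  assumes "simple_graph V E"
  obtains c where "proper_coloring V E (chromatic_number V E) c"
proof -
  have fin: "finite V" using assms by (simp add: simple_graph_def)
  obtain h where "bij_betw h V {0..<card V}" using ex_bij_betw_finite_nat[OF fin] by blast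
  then have h: "h ` V = {0..<card V}" "inj_on h V" by (auto simp: bij_betw_def)
  \<comment> \<open>An injective numbering of \<open>V\<close> is a proper colouring, so the minimum
    defining the chromatic number is attained.\<close>
  have "h u \<noteq> h v" if "u \<in> V" "v \<in> V" "{u, v} \<in> E" for u v
  proof -
    have "card {u, v} = 2" using assms that by (simp add: simple_graph_def)
    then have "u \<noteq> v" by auto
    then show ?thesis using h(2) that by (auto simp: inj_on_def)
  qed
  moreover have "h v < card V" if "v \<in> V" for v using h(1) that by auto
  ultimately have "proper_coloring V E (card V) h" by (simp add: proper_coloring_def)
  then have "\<exists>n c. proper_coloring V E n c" by blast
  then have "\<exists>c. proper_coloring V E (LEAST n. \<exists>c. proper_coloring V E n c) c" by (rule LeastI_ex)
  then show ?thesis using that unfolding chromatic_number_def by blast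
qed

lemma exists_refining_index:
  fixes c :: "'v \<Rightarrow> nat"
  assumes "finite V"
  obtains idx :: "'v \<Rightarrow> nat" where "inj_on idx V"
    "\<And>u v. u \<in> V \<Longrightarrow> v \<in> V \<Longrightarrow> c u < c v \<Longrightarrow> idx u < idx v"
proof -
  obtain h where "bij_betw h V {0..<card V}" using ex_bij_betw_finite_nat[OF assms] by blast
  then have h: "inj_on h V" "\<And>v. v \<in> V \<Longrightarrow> h v < card V" by (auto simp: bij_betw_def)
  \<comment> \<open>Sorts by \<open>c\<close> first and breaks ties by the numbering
    \<open>h\<close>, whose values on \<open>V\<close> are below \<open>card V\<close>.\<close>
  define idx where "idx v = c v * card V + h v" for v
  have less: "idx u < idx v" if "u \<in> V" "v \<in> V" "c u < c v" for u v
    using mult_le_mono1[of "Suc (c u)" "c v" "card V"] h(2)[OF that(1)] that by (simp add: idx_def)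
  moreover have "inj_on idx V"
  proof (rule inj_onI)
    fix u v assume uv: "u \<in> V" "v \<in> V" "idx u = idx v"
    then have "c u = c v" using less[of u v] less[of v u] by (metis linorder_neqE_nat less_irrefl)
    then show "u = v" using uv h(1) by (auto simp: idx_def inj_on_def)
  qed
  ultimately show ?thesis using that by blast
qed

theorem theorem1p1:
  fixes k d :: nat
    and V :: "'v set"
    and E :: "'v set set"
  assumes "k \<ge> 3"
    and "\<not> CHAR('k::alg_closed_field) dvd k"
    and "simple_graph V E"
    and "chromatic_number V E = k + 1"
    and "girth E > enat (4 * k)"
    and "ereal (real d + real k - 1) < ereal_of_enat (girth E) / ereal (4 * real k)"
  shows "\<not> (\<exists>(r :: 'v \<Rightarrow> ('v, 'k) mpoly) (s :: 'v set \<Rightarrow> ('v, 'k) mpoly).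
            (\<forall>u\<in>V. r u \<in> polys_in V \<and> total_degree (r u) \<le> d) \<and>
            (\<forall>e\<in>E. s e \<in> polys_in V \<and> total_degree (s e) \<le> d) \<and>
            (\<Sum>u\<in>V. r u * vertex_poly k u) + (\<Sum>e\<in>E. s e * edge_poly k e) = 1)"
proof -
  have fin: "finite V" and edges: "\<And>e. e \<in> E \<Longrightarrow> e \<subseteq> V \<and> card e = 2"
    using assms(3) by (auto simp: simple_graph_def)
  have edge_V: "u \<in> V" "v \<in> V" if "{u, v} \<in> E" for u v
    using edges[OF that] by auto
  obtain c where "proper_coloring V E (k + 1) c"
    using proper_coloring_chromatic_number[OF assms(3)] assms(4) by metis
  then have c_le: "\<And>v. v \<in> V \<Longrightarrow> c v \<le> k" and c_neq: "\<And>u v. {u, v} \<in> E \<Longrightarrow> c u \<noteq> c v"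
    using edge_V by (auto simp: proper_coloring_def less_Suc_eq_le)
  obtain idx :: "'v \<Rightarrow> nat" where idx: "inj_on idx V"
    "\<And>u v. u \<in> V \<Longrightarrow> v \<in> V \<Longrightarrow> c u < c v \<Longrightarrow> idx u < idx v"
    using exists_refining_index[OF fin] by metis
  interpret reduction V E c idx k "TYPE('k)"
  proof
    show "of_nat k \<noteq> (0 :: 'k)" using assms(2) by (simp add: of_nat_eq_0_iff_char_dvd)
    show "card (roots_of_unity k :: 'k set) \<ge> 3"
      using card_roots_of_unity[OF assms(2)] assms(1) by simp
  qed (use fin edge_V c_neq idx in auto)
  have long: "length xs > (d + 2) * (2 * k + 3)" if xs: "is_cycle E xs" for xs
  proof -
    have "girth E \<le> enat (length xs)" unfolding girth_def using xs by (intro INF_lower) auto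
    then have "ereal_of_enat (girth E) \<le> ereal (real (length xs))"
      by (metis ereal_of_enat_le_iff ereal_of_enat_simps(1))
    then have "ereal_of_enat (girth E) / ereal (4 * real k) \<le> ereal (real (length xs)) / ereal (4 * real k)"
      using assms(1) by (intro ereal_divide_right_mono) auto
    with assms(6) have "ereal (real d + real k - 1) < ereal (real (length xs)) / ereal (4 * real k)"
      by (rule less_le_trans)
    then have "real d + real k - 1 < real (length xs) / (4 * real k)" using assms(1) by simp
    then have "(real d + real k - 1) * (4 * real k) < real (length xs)"
      using assms(1) by (simp add: pos_less_divide_eq)
    moreover have "real d + real k - 1 = real (d + k - 1)" using assms(1) by simp
    ultimately have "(d + k - 1) * (4 * k) < length xs"
      by (metis of_nat_less_iff of_nat_mult of_nat_numeral)
    \<comment> \<open>For \<open>k \<ge> 3\<close> the factors compare separately: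
      \<open>d + 2 \<le> d + k - 1\<close> and \<open>2 * k + 3 \<le> 4 * k\<close>.\<close>
    moreover have "(d + 2) * (2 * k + 3) \<le> (d + k - 1) * (4 * k)"
      using assms(1) by (intro mult_le_mono) auto
    ultimately show ?thesis by linarith
  qed
  have "tractable (path_closure E c S)" if S_V: "S \<subseteq> V" "card S \<le> d + 2" for S
  proof -
    interpret long_cycles E c k "d + 2" S
      using S_V fin c_le c_neq edge_V long by unfold_locales (auto intro: finite_subset)
    show ?thesis
      using path_closure_two_colourable[OF fin S_V(1) edge_V(1)] path_closure_subset_V[OF S_V(1)]
        path_closed_path_closure by (simp add: tractable_def)
  qed
  then have "(\<Sum>u\<in>V. r u * vertex_poly k u) + (\<Sum>e\<in>E. s e * edge_poly k e) \<noteq> 1"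
    if "\<forall>e\<in>E. s e \<in> polys_in V \<and> total_degree (s e) \<le> d"
    for r :: "'v \<Rightarrow> ('v, 'k) mpoly" and s
    using edges that by (intro no_certificate[where d = d]) auto
  then show ?thesis by meson
qed

end
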